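(* Let $\mathcal{E}\le F$ be the planar $3$-colorable subgroup, $\mathcal{F}\le F$ the $3$-colorable subgroup, and $\mathcal{E}_{\rm EVEN}=\mathcal{E}\cap K_{(2,2)}$. Then $$\mathcal{E}_{\rm EVEN}=\langle x_0^2,\varphi_R(\mathcal{F})\rangle=\langle x_0^2,\varphi_L(\mathcal{F})\rangle .$$
   Context: Thompson's group $F$ is the group of piecewise linear homeomorphisms of $[0,1]$ differentiable except at finitely many dyadic rationals, with all slopes powers of $2$; the product is $(f\cdot g)(t)=g(f(t))$. In binary expansions, $x_0$ is the element $.00\alpha\mapsto .0\alpha$, $.01\alpha\mapsto .10\alpha$, $.1\alpha\mapsto .11\alpha$. The rectangular subgroup is $K_{(2,2)}=\{f\in F: \log_2 f'(0)\in 2\mathbb{Z},\ \log_2 f'(1)\in 2\mathbb{Z}\}$. Tree diagrams: a tree diagram is a pair $(T_+,T_-)$ of finite planar rooted binary trees with the same number $n$ of leaves. Vertices are finite binary words (root = empty word, $v0$ and $v1$ = left and right child of $v$). It represents the element of $F$ sending $.\alpha_k\gamma$ to $.\beta_k\gamma$ for each $k$ and each infinite binary word $\gamma$, where $\alpha_k,\beta_k$ are the $k$-th leaves (from left to right) of $T_+,T_-$. Every element of $F$ is so represented, uniquely up to inserting/deleting pairs of opposing carets. One draws $T_-$ upside down below $T_+$ and identifies the $k$-th leaves of the two trees. Planar $3$-colorable subgroup $\mathcal{E}$: ignoring edges sprouting upward/downward from the two roots, the diagram partitions the plane into regions: the outer region $R_0=R_n$ and, for $1\le i\le n-1$, the region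 $R_i$ between the $i$-th and $(i+1)$-th leaves. If $v$ is a non-root vertex of $T_+$ or $T_-$ whose descendant leaves are numbers $p+1,\dots,q$, the edge from $v$ to its parent separates $R_p$ from $R_q$. $\mathcal{E}$ is the subgroup of elements whose plane partition is $3$-colorable: there is a map $c$ from the regions to $\mathbb{Z}_3$ giving different colors to regions sharing an edge, i.e. $c(R_p)\neq c(R_q)$ for each such $v$. This does not depend on the tree diagram chosen. $3$-colorable subgroup $\mathcal{F}$: here each root is joined by an edge to the corresponding boundary line of a horizontal strip containing the diagram, so the strip has a leftmost region $R_0$ and a distinct rightmost region $R_n$, besides $R_1,\dots,R_{n-1}$. $\mathcal{F}$ is the subgroup of elements for which the strip is $3$-colorable: there are colors $c(R_0),\dots,c(R_n)\in\mathbb{Z}_3$ with $c(R_p)\ne c(R_q)$ for every vertex $v$ (including the roots) of $T_+$ or $T_-$ with descendant leaves numbered $p+1,\dots,q$. Shift endomorphisms of $F$: $\varphi_R(g)(t)=t$ for $t\in[0,1/2]$ and $\varphi_R(g)(t)=\tfrac12+\tfrac12 g(2t-1)$ for $t\in[1/2,1]$; $\varphi_L(g)(t)=\tfrac12 g(2t)$ for $t\in[0,1/2]$ and $\varphi_L(g)(t)=t$ for $t\in[1/2,1]$. *)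

theory Defs
  imports "HOL-Analysis.Analysis" "HOL-Algebra.Generated_Groups"
    "HOL-Library.Stream" "HOL-Library.Sublist" "HOL-Library.Numeral_Type"
begin

definition dyadic_rationals :: "real set" where
  "dyadic_rationals = {of_int a / 2 ^ n | (a::int) (n::nat). True}"

text \<open>\<open>D\<close> is a subdivision of the unit interval with dyadic points; \<open>f\<close> is affine between
  consecutive points of \<open>D\<close>. Slopes are positive, so such an \<open>f\<close> is increasing.\<close>
definition dyadic_piecewise_linear :: "(real \<Rightarrow> real) \<Rightarrow> bool" where
  "dyadic_piecewise_linear f \<longleftrightarrow>
     (\<exists>D. finite D \<and> D \<subseteq> dyadic_rationals \<inter> {0..1} \<and> {0, 1} \<subseteq> D \<and>
        (\<forall>a\<in>D. \<forall>b\<in>D. a < b \<and> {a<..<b} \<inter> D = {} \<longrightarrow>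
           (\<exists>(k::int) (d::real). \<forall>t\<in>{a..b}. f t = 2 powi k * t + d)))"

text \<open>A homeomorphism of the unit interval is represented by its extension to the real line
  by the identity, so that equality of elements of the group is equality of functions.
  Products are written in the order of application: \<open>f \<cdot> g\<close> is \<open>f\<close> followed by \<open>g\<close>.\<close>
definition thompson_F :: "(real \<Rightarrow> real) monoid" where
  "thompson_F =
     \<lparr>carrier = {f. (\<exists>g. homeomorphism {0..1} {0..1} f g) \<and> dyadic_piecewise_linear f \<and>
                    (\<forall>t. t \<notin> {0..1} \<longrightarrow> f t = t)},
      mult = (\<lambda>f g t. g (f t)),
      one = (\<lambda>t. t)\<rparr>"

text \<open>The derivatives at the end points are one-sided.\<close>
definition K22 :: "(real \<Rightarrow> real) set" where
  "K22 = {f \<in> carrier thompson_F.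
     (\<exists>a b. (f has_real_derivative a) (at 0 within {0..1}) \<and>
            (f has_real_derivative b) (at 1 within {0..1}) \<and>
            (\<exists>k::int. log 2 a = 2 * of_int k) \<and> (\<exists>l::int. log 2 b = 2 * of_int l))}"

text \<open>The real number with the given binary expansion; \<open>False\<close> and \<open>True\<close> are the digits 0, 1.\<close>
definition binary_value :: "bool stream \<Rightarrow> real" where
  "binary_value s = (\<Sum>n. of_bool (s !! n) / 2 ^ Suc n)"

definition x0 :: "real \<Rightarrow> real" where
  "x0 t = (if t \<in> {0..1/4} then 2 * t
           else if t \<in> {1/4..1/2} then t + 1/4
           else if t \<in> {1/2..1} then t / 2 + 1/2
           else t)"

lemma binary_value_summable: "summable (\<lambda>n. of_bool (s !! n) / 2 ^ Suc n :: real)"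
proof (rule summable_comparison_test')
  show "summable (\<lambda>n. (1/2) ^ n :: real)" by simp
  show "norm (of_bool (s !! n) / 2 ^ Suc n :: real) \<le> (1/2) ^ n" for n
    by (simp add: power_divide field_simps)
qed

lemma binary_value_Cons:
  "binary_value (b ## s) = of_bool b / 2 + binary_value s / 2"
proof -
  have "binary_value (b ## s) =
      of_bool b / 2 + (\<Sum>n. of_bool (s !! n) / 2 ^ Suc (Suc n))"
    unfolding binary_value_def
    using suminf_split_head[OF binary_value_summable, of "b ## s"] by simp
  also have "(\<Sum>n. of_bool (s !! n) / 2 ^ Suc (Suc n) :: real) = binary_value s / 2"
    unfolding binary_value_def
    using suminf_divide[OF binary_value_summable[of s], of 2] by (simp add: mult.commute)
  finally show ?thesis .
qed

lemma binary_value_in_unit: "binary_value s \<in> {0..1}"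
proof -
  have "0 \<le> binary_value s"
    unfolding binary_value_def by (rule suminf_nonneg[OF binary_value_summable]) simp
  moreover have "binary_value s \<le> (\<Sum>n. (1/2) ^ Suc n)"
    unfolding binary_value_def
    by (rule suminf_le[OF _ binary_value_summable sums_summable[OF power_half_series]])
       (simp add: power_divide field_simps)
  moreover have "(\<Sum>n. (1/2::real) ^ Suc n) = 1"
    using power_half_series by (rule sums_unique[symmetric])
  ultimately show ?thesis by simp
qed

lemma x0_binary:
  "x0 (binary_value ([False, False] @- s)) = binary_value ([False] @- s)"
  "x0 (binary_value ([False, True] @- s)) = binary_value ([True, False] @- s)"
  "x0 (binary_value ([True] @- s)) = binary_value ([True, True] @- s)"
  using binary_value_in_unit[of s] by (auto simp: x0_def binary_value_Cons field_simps)

datatype btree = Leaf | Node btree btree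

text \<open>Vertices are binary words (\<open>False\<close> = left, \<open>True\<close> = right); \<open>leaves\<close> lists from left to right.\<close>
fun vertices :: "btree \<Rightarrow> bool list set" where
  "vertices Leaf = {[]}"
| "vertices (Node l r) = {[]} \<union> (#) False ` vertices l \<union> (#) True ` vertices r"

fun leaves :: "btree \<Rightarrow> bool list list" where
  "leaves Leaf = [[]]"
| "leaves (Node l r) = map ((#) False) (leaves l) @ map ((#) True) (leaves r)"

text \<open>The leaves below a vertex, numbered from 1.\<close>
definition descendant_leaves :: "btree \<Rightarrow> bool list \<Rightarrow> nat set" where
  "descendant_leaves T v = {i \<in> {1..length (leaves T)}. prefix v (leaves T ! (i - 1))}"

definition tree_diagram :: "btree \<Rightarrow> btree \<Rightarrow> bool" where
  "tree_diagram Tp Tm \<longleftrightarrow> length (leaves Tp) = length (leaves Tm)"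

definition represents :: "btree \<Rightarrow> btree \<Rightarrow> (real \<Rightarrow> real) \<Rightarrow> bool" where
  "represents Tp Tm f \<longleftrightarrow> tree_diagram Tp Tm \<and>
     (\<forall>k < length (leaves Tp). \<forall>s.
        f (binary_value (leaves Tp ! k @- s)) = binary_value (leaves Tm ! k @- s))"

text \<open>\<open>c i\<close> is the colour of the \<open>i\<close>-th region. The set of descendant leaves of a vertex is a
  nonempty interval \<open>{p+1..q}\<close>, which determines \<open>p\<close> and \<open>q\<close>; the edge going up from the
  vertex separates the regions \<open>p\<close> and \<open>q\<close>. \<open>V\<close> is the set of vertices whose edge is counted.\<close>
definition proper_colouring :: "(nat \<Rightarrow> 3) \<Rightarrow> btree \<Rightarrow> bool list set \<Rightarrow> bool" where
  "proper_colouring c T V \<longleftrightarrow>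
     (\<forall>v\<in>V. \<forall>p q. descendant_leaves T v = {p+1..q} \<longrightarrow> c p \<noteq> c q)"

definition planar_3_colorable :: "btree \<Rightarrow> btree \<Rightarrow> bool" where
  "planar_3_colorable Tp Tm \<longleftrightarrow>
     (\<exists>c. c 0 = c (length (leaves Tp)) \<and>
          proper_colouring c Tp (vertices Tp - {[]}) \<and>
          proper_colouring c Tm (vertices Tm - {[]}))"

definition strip_3_colorable :: "btree \<Rightarrow> btree \<Rightarrow> bool" where
  "strip_3_colorable Tp Tm \<longleftrightarrow>
     (\<exists>c. proper_colouring c Tp (vertices Tp) \<and> proper_colouring c Tm (vertices Tm))"

text \<open>Colourability does not depend on the tree diagram representing the element, because
  inserting or deleting a pair of opposing carets preserves it.\<close>
definition planar_3_colorable_subgroup :: "(real \<Rightarrow> real) set" where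
  "planar_3_colorable_subgroup =
     {f \<in> carrier thompson_F. \<exists>Tp Tm. represents Tp Tm f \<and> planar_3_colorable Tp Tm}"

definition three_colorable_subgroup :: "(real \<Rightarrow> real) set" where
  "three_colorable_subgroup =
     {f \<in> carrier thompson_F. \<exists>Tp Tm. represents Tp Tm f \<and> strip_3_colorable Tp Tm}"

definition E_EVEN :: "(real \<Rightarrow> real) set" where
  "E_EVEN = planar_3_colorable_subgroup \<inter> K22"

definition phi_R :: "(real \<Rightarrow> real) \<Rightarrow> real \<Rightarrow> real" where
  "phi_R g t = (if t \<in> {1/2..1} then 1/2 + 1/2 * g (2 * t - 1) else t)"

definition phi_L :: "(real \<Rightarrow> real) \<Rightarrow> real \<Rightarrow> real" where
  "phi_L g t = (if t \<in> {0..1/2} then 1/2 * g (2 * t) else t)"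

end

theory Submission imports Defs begin

text \<open>Adding the colour differences along the leaves turns colourability into parity conditions. A
  proper strip colouring of a tree gives the \<open>i\<close>-th leaf, of depth \<open>d\<close>, the difference \<open>(-1)^d r\<close>,
  where \<open>r\<close> is the difference at the root, so \<open>\<F>\<close> consists of the elements whose slopes
  are all even powers of 2. In the planar case there is an extra sign on the right half, so
  \<open>E_EVEN\<close> consists of the elements for which the logarithm of the slope at \<open>t\<close> is even if and
  only if \<open>t\<close> and its image lie on the same side of \<open>1/2\<close>. In particular the elements of
  \<open>E_EVEN\<close> that are trivial on \<open>[0, 1/2]\<close> are exactly \<open>\<phi>\<^sub>R(\<F>)\<close>. An arbitrary \<open>f\<close> in
  \<open>E_EVEN\<close> has slope \<open>4^m\<close> at 0, and \<open>x\<^sub>0\<^sup>2\<close> has slope 4 there and expands every neighbourhood of 0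
  to the left half; so \<open>a\<inverse> f b\<close> is trivial on \<open>[0, 1/2]\<close> for suitable powers \<open>a\<close>, \<open>b\<close> of
  \<open>x\<^sub>0\<^sup>2\<close>. The reflection \<open>t \<mapsto> 1 - t\<close> exchanges the two generating sets, up to inverting \<open>x\<^sub>0\<^sup>2\<close>.\<close>

subsection \<open>Words and standard dyadic intervals\<close>

text \<open>\<open>word_left u\<close> and \<open>word_left u + 1 / 2 ^ length u\<close> are the
  ends of the standard dyadic interval of the numbers with an expansion beginning with
  \<open>u\<close>.\<close>

fun word_left :: "bool list \<Rightarrow> real" where
  "word_left [] = 0"
| "word_left (b # u) = of_bool b / 2 + word_left u / 2"

lemma word_left_append: "word_left (u @ w) = word_left u + word_left w / 2 ^ length u"
  by (induction u) (auto simp: field_simps)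

lemma word_left_bounds: "0 \<le> word_left u" "word_left u + 1 / 2 ^ length u \<le> 1"
proof (induction u)
  case (Cons b u)
  have "word_left (b # u) + 1 / 2 ^ length (b # u) = of_bool b / 2 + (word_left u + 1 / 2 ^ length u) / 2"
    by (simp add: field_simps)
  also have "\<dots> \<le> 1 / 2 + 1 / 2"
    using Cons by (intro add_mono divide_right_mono) auto
  finally show "word_left (b # u) + 1 / 2 ^ length (b # u) \<le> 1" by simp
  show "0 \<le> word_left (b # u)" using Cons by simp
qed simp_all

lemma word_left_less_1: "word_left u < 1"
proof -
  have "(0::real) < 1 / 2 ^ length u" by simp
  then show ?thesis using word_left_bounds(2)[of u] by linarith
qed

lemma word_left_eq_iff: "length u = length v \<Longrightarrow> word_left u = word_left v \<longleftrightarrow> u = v"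
proof (induction u v rule: list_induct2)
  case (Cons a u b v)
  then show ?case
    using word_left_bounds(1)[of u] word_left_bounds(1)[of v] word_left_less_1[of u] word_left_less_1[of v]
    by (cases a; cases b) auto
qed simp

lemma word_left_replicate_False [simp]: "word_left (replicate n False) = 0"
  by (induction n) auto

lemma word_left_eq_0: "word_left u = 0 \<Longrightarrow> u = replicate (length u) False"
  using word_left_eq_iff[of u "replicate (length u) False"] by simp

lemma word_left_dyadic: "\<exists>j<2 ^ length u. word_left u = real j / 2 ^ length u"
proof (induction u)
  case (Cons b u)
  then obtain j where j: "j < 2 ^ length u" "word_left u = real j / 2 ^ length u" by blast
  show ?case
    by (rule exI[of _ "of_bool b * 2 ^ length u + j"]) (use j in \<open>auto simp: field_simps\<close>)
qed simp

lemma ex_word: "j < 2 ^ n \<Longrightarrow> \<exists>u. length u = n \<and> word_left u = real j / 2 ^ n"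
proof (induction n arbitrary: j)
  case (Suc n)
  define b where "b \<longleftrightarrow> 2 ^ n \<le> j"
  define i where "i = (if b then j - 2 ^ n else j)"
  have "i < 2 ^ n" using Suc.prems by (auto simp: i_def b_def)
  then obtain u where u: "length u = n" "word_left u = real i / 2 ^ n" using Suc.IH by blast
  have "word_left (b # u) = real j / 2 ^ Suc n"
    using u by (auto simp: i_def b_def of_nat_diff field_simps)
  then show ?case using u(1) by (intro exI[of _ "b # u"]) simp
qed simp

lemma binary_value_append: "binary_value (u @- s) = word_left u + binary_value s / 2 ^ length u"
  by (induction u) (auto simp: binary_value_Cons field_simps)

lemma binary_value_surj:
  assumes "t \<in> {0..1}"
  shows "\<exists>s. binary_value s = t"
proof -
  \<comment> \<open>Orbit of \<open>t\<close> under doubling modulo 1; the \<open>n\<close>-th digit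
    records whether \<open>a n\<close> is at least 1/2. The point 1 is kept fixed, so it receives
    the expansion .111...\<close>
  define a where "a = rec_nat t (\<lambda>_ x. if 1/2 \<le> x then 2 * x - 1 else 2 * x)"
  have a_Suc: "a (Suc n) = (if 1/2 \<le> a n then 2 * a n - 1 else 2 * a n)" for n
    by (simp add: a_def)
  have a0: "a 0 = t" by (simp add: a_def)
  have a_in: "a n \<in> {0..1}" for n
    by (induction n) (use assms in \<open>auto simp: a0 a_Suc\<close>)
  define s where "s = smap (\<lambda>n. 1/2 \<le> a n) nats"
  have partial: "(\<Sum>i<n. of_bool (s !! i) / 2 ^ Suc i) = t - a n / 2 ^ n" for n
    by (induction n) (auto simp: a0 a_Suc s_def field_simps)
  have "(\<lambda>n. t - a n / 2 ^ n) \<longlonglongrightarrow> t - 0"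
  proof (intro tendsto_intros)
    show "(\<lambda>n. a n / 2 ^ n) \<longlonglongrightarrow> 0"
    proof (rule tendsto_sandwich[OF _ _ tendsto_const])
      show "\<forall>\<^sub>F n in sequentially. a n / 2 ^ n \<le> (1/2) ^ n"
        using a_in by (auto simp: power_divide field_simps)
      show "\<forall>\<^sub>F n in sequentially. 0 \<le> a n / 2 ^ n" using a_in by auto
      show "(\<lambda>n. (1/2::real) ^ n) \<longlonglongrightarrow> 0" by (rule LIMSEQ_power_zero) simp
    qed
  qed
  then have "(\<lambda>n. of_bool (s !! n) / 2 ^ Suc n) sums t"
    unfolding sums_def partial by simp
  then show ?thesis unfolding binary_value_def by (auto dest: sums_unique)
qed

text \<open>One branch of a tree diagram: \<open>f\<close> carries the standard dyadic interval of
  \<open>u\<close> affinely onto that of \<open>x\<close>, with \<open>r\<close> as relative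
  position. A real \<open>r\<close> in place of an infinite word gives direct access to slopes and
  end points.\<close>

definition maps_word :: "(real \<Rightarrow> real) \<Rightarrow> bool list \<Rightarrow> bool list \<Rightarrow> bool" where
  "maps_word f u x \<longleftrightarrow>
     (\<forall>r\<in>{0..1}. f (word_left u + r / 2 ^ length u) = word_left x + r / 2 ^ length x)"

lemma maps_word_iff_binary_value:
  "maps_word f u x \<longleftrightarrow> (\<forall>s. f (binary_value (u @- s)) = binary_value (x @- s))"
  unfolding maps_word_def binary_value_append using binary_value_surj binary_value_in_unit by metis

lemma represents_iff:
  "represents Tp Tm f \<longleftrightarrow> tree_diagram Tp Tm \<and>
     (\<forall>k < length (leaves Tp). maps_word f (leaves Tp ! k) (leaves Tm ! k))"
  unfolding represents_def maps_word_iff_binary_value ..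

lemma maps_word_left: "maps_word f u x \<Longrightarrow> f (word_left u) = word_left x"
  unfolding maps_word_def by (drule bspec[of _ _ 0]) auto

lemma maps_word_right:
  "maps_word f u x \<Longrightarrow> f (word_left u + 1 / 2 ^ length u) = word_left x + 1 / 2 ^ length x"
  unfolding maps_word_def by (drule bspec[of _ _ 1]) auto

lemma maps_word_append:
  assumes "maps_word f u x" shows "maps_word f (u @ w) (x @ w)"
  using assms unfolding maps_word_iff_binary_value by (metis shift_append)

text \<open>The image interval determines the word: its length fixes the word length, and its left
  end point then fixes the letters.\<close>

lemma maps_word_unique:
  assumes "maps_word f u x" "maps_word f u y" shows "x = y"
proof -
  have left: "word_left x = word_left y" using assms maps_word_left by metis
  then have "1 / 2 ^ length x = (1 / 2 ^ length y :: real)"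
    using assms maps_word_right by (metis add_left_cancel)
  then have "length x = length y" by simp
  then show ?thesis using left word_left_eq_iff by blast
qed

lemma maps_word_cancel:
  assumes "maps_word f (u @ w) y" "maps_word f u x" shows "y = x @ w"
  using assms maps_word_append maps_word_unique by blast

lemma maps_word_comp: "maps_word f u x \<Longrightarrow> maps_word g x y \<Longrightarrow> maps_word (\<lambda>t. g (f t)) u y"
  by (simp add: maps_word_def)

lemma maps_word_ident: "maps_word (\<lambda>t. t) u u"
  by (simp add: maps_word_def)

lemma word_interval_subset:
  assumes "r \<in> {0..1}" shows "word_left u + r / 2 ^ length u \<in> {0..1}"
proof -
  have "r / 2 ^ length u \<le> 1 / 2 ^ length u" "0 \<le> r / 2 ^ length u"
    using assms by (auto intro: divide_right_mono)
  then show ?thesis using word_left_bounds[of u] by auto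
qed

lemma maps_word_inverse:
  assumes "maps_word f u x" "\<And>t. t \<in> {0..1} \<Longrightarrow> g (f t) = t" shows "maps_word g x u"
  using assms word_interval_subset unfolding maps_word_def by metis

text \<open>The logarithm of the slope is \<open>length u - length x\<close>, hence even exactly
  when \<open>length u + length x\<close> is even. All parity conditions on slopes are read off word
  lengths in this way.\<close>

lemma maps_word_affine:
  assumes "maps_word f u x" "t \<in> {word_left u..word_left u + 1 / 2 ^ length u}"
  shows "f t = 2 powi (int (length u) - int (length x)) * t
               + (word_left x - 2 powi (int (length u) - int (length x)) * word_left u)"
proof -
  define r where "r = (t - word_left u) * 2 ^ length u"
  have t: "t = word_left u + r / 2 ^ length u" by (simp add: r_def)
  have "(t - word_left u) * 2 ^ length u \<le> (1 / 2 ^ length u) * 2 ^ length u"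
    by (rule mult_right_mono) (use assms(2) in auto)
  then have "r \<in> {0..1}" using assms(2) by (auto simp: r_def)
  then have "f t = word_left x + r / 2 ^ length x" using assms(1) unfolding maps_word_def t by blast
  moreover have "2 powi (int (length u) - int (length x)) = (2 ^ length u / 2 ^ length x :: real)"
    by (simp add: power_int_diff)
  ultimately have "f t = word_left x
      + 2 powi (int (length u) - int (length x)) * (t - word_left u)"
    by (simp add: r_def)
  then show ?thesis by (simp add: algebra_simps)
qed

subsection \<open>Trees and colourings\<close>

lemma leaves_not_Nil [simp]: "leaves T \<noteq> []"
  by (induction T) auto

lemma length_leaves_eq_1: "length (leaves T) = 1 \<longleftrightarrow> T = Leaf"
proof (cases T)
  case (Node l r)
  have "0 < length (leaves l)" "0 < length (leaves r)" by simp_all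
  then have "length (leaves T) \<noteq> 1"
    unfolding Node leaves.simps length_append length_map by linarith
  then show ?thesis using Node by blast
qed simp

text \<open>Descending from the root along \<open>u\<close> either meets a leaf on the way or ends
  at a vertex with leaves below it.\<close>

lemma leaf_comparable: "\<exists>i<length (leaves T). prefix u (leaves T ! i) \<or> prefix (leaves T ! i) u"
proof -
  have "\<exists>a\<in>set (leaves T). prefix u a \<or> prefix a u"
  proof (induction T arbitrary: u)
    case (Node l r)
    show ?case
    proof (cases u)
      case Nil
      then show ?thesis by (metis Nil_prefix leaves_not_Nil list.set_sel(1))
    next
      case (Cons b w)
      obtain a a' where "a \<in> set (leaves l)" "prefix w a \<or> prefix a w"
        "a' \<in> set (leaves r)" "prefix w a' \<or> prefix a' w"
        using Node.IH by metis
      then show ?thesis unfolding Cons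
        by (intro bexI[of _ "b # (if b then a' else a)"]) auto
    qed
  qed simp
  then show ?thesis by (metis in_set_conv_nth)
qed

section \<open>Sequences of adjacent dyadic intervals and their trees\<close>

fun word_chain :: "bool list list \<Rightarrow> real \<Rightarrow> real \<Rightarrow> bool" where
  "word_chain [] a b \<longleftrightarrow> a = b"
| "word_chain (w # ws) a b \<longleftrightarrow> word_left w = a \<and> word_chain ws (a + 1 / 2 ^ length w) b"

lemma word_chain_append:
  "word_chain (us @ vs) a b \<longleftrightarrow> (\<exists>c. word_chain us a c \<and> word_chain vs c b)"
  by (induction us arbitrary: a) auto

lemma word_chain_map_Cons:
  "word_chain (map ((#) d) ws) a b \<longleftrightarrow> word_chain ws (2 * a - of_bool d) (2 * b - of_bool d)"
  by (induction ws arbitrary: a) (auto simp: algebra_simps)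

lemma word_chain_le: "word_chain ws a b \<Longrightarrow> a \<le> b"
proof (induction ws arbitrary: a)
  case (Cons w ws)
  then have "a + 1 / 2 ^ length w \<le> b" by simp
  moreover have "0 \<le> (1 / 2 ^ length w :: real)" by simp
  ultimately show ?case by linarith
qed simp

lemma word_chain_refl: "word_chain ws a a \<Longrightarrow> ws = []"
proof (cases ws)
  case (Cons w ws')
  assume "word_chain ws a a"
  then have "a + 1 / 2 ^ length w \<le> a" using Cons word_chain_le[of ws' "a + 1 / 2 ^ length w" a] by simp
  moreover have "0 < 1 / (2::real) ^ length w" by simp
  ultimately have False by linarith
  then show ?thesis ..
qed simp

lemma word_chain_leaves: "word_chain (leaves T) 0 1"
proof (induction T)
  case (Node l r)
  then have "word_chain (map ((#) False) (leaves l)) 0 (1/2)"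
    and "word_chain (map ((#) True) (leaves r)) (1/2) 1"
    by (simp_all add: word_chain_map_Cons)
  then show ?case by (auto simp: word_chain_append)
qed simp

lemma word_chain_right_half:
  assumes "word_chain ws a b" "1/2 \<le> a" "[] \<notin> set ws"
  shows "\<exists>vs. ws = map ((#) True) vs"
  using assms
proof (induction ws arbitrary: a)
  case (Cons w ws)
  then obtain d v where w: "w = d # v" by (cases w) auto
  have "d" using Cons.prems w word_left_less_1[of v] by (cases d) auto
  moreover have "0 \<le> (1 / 2 ^ length w :: real)" by simp
  then have "1/2 \<le> a + 1 / 2 ^ length w" using Cons.prems(2) by linarith
  then obtain vs where "ws = map ((#) True) vs"
    using Cons.IH[of "a + 1 / 2 ^ length w"] Cons.prems by fastforce
  ultimately show ?case using w by (intro exI[of _ "v # vs"]) auto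
qed simp

text \<open>The interval of a nonempty word never has 1/2 in its interior, so a sequence of adjacent
  intervals leading from \<open>a\<close> to 1 can be cut at 1/2. Removing the first letters
  rescales each half to the unit interval, hence the \<open>2 * a\<close>.\<close>

lemma word_chain_split:
  assumes "word_chain ws a 1" "a \<le> 1/2" "[] \<notin> set ws"
  shows "\<exists>us vs. ws = map ((#) False) us @ map ((#) True) vs \<and>
           word_chain us (2 * a) 1 \<and> word_chain vs 0 1"
  using assms
proof (induction ws arbitrary: a)
  case (Cons w ws)
  then obtain d v where w: "w = d # v" by (cases w) auto
  show ?case
  proof (cases d)
    case True
    then have a: "a = 1/2" using Cons.prems w word_left_bounds(1)[of v] by auto
    then have "1/2 \<le> a" by simp
    then obtain vs where vs: "w # ws = map ((#) True) vs"
      using word_chain_right_half[OF Cons.prems(1) _ Cons.prems(3)] by metis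
    then have "word_chain vs 0 1" using Cons.prems(1) a unfolding vs word_chain_map_Cons by simp
    then show ?thesis using vs a by (intro exI[of _ "[]"] exI[of _ vs]) auto
  next
    case False
    have "a + 1 / 2 ^ length w = (word_left v + 1 / 2 ^ length v) / 2"
      using Cons.prems(1) w False by (simp add: field_simps)
    then have "a + 1 / 2 ^ length w \<le> 1/2" using word_left_bounds(2)[of v] by simp
    moreover have "word_chain ws (a + 1 / 2 ^ length w) 1" "[] \<notin> set ws"
      using Cons.prems by auto
    ultimately obtain us vs where *: "ws = map ((#) False) us @ map ((#) True) vs"
      "word_chain us (2 * (a + 1 / 2 ^ length w)) 1" "word_chain vs 0 1"
      using Cons.IH by metis
    have "word_chain (v # us) (2 * a) 1"
      using *(2) Cons.prems(1) w False by (simp add: algebra_simps)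
    then show ?thesis using * w False by (intro exI[of _ "v # us"] exI[of _ vs]) auto
  qed
qed simp

text \<open>Induction on a bound for the word lengths. The interval of the empty word is the whole
  unit interval and leaves no room for other words; without it, cutting at 1/2 yields the leaves of
  the two subtrees.\<close>

lemma ex_tree_leaves:
  assumes "word_chain ws 0 1"
  shows "\<exists>T. leaves T = ws"
proof -
  have "\<forall>w\<in>set ws. length w \<le> n \<Longrightarrow> word_chain ws 0 1 \<Longrightarrow> \<exists>T. leaves T = ws" for n ws
  proof (induction n arbitrary: ws)
    case (0 ws)
    then obtain vs where "ws = [] # vs" by (cases ws) auto
    then show ?case using 0 word_chain_refl[of vs 1] by (intro exI[of _ Leaf]) auto
  next
    case (Suc n ws)
    show ?case
    proof (cases "[] \<in> set ws")
      case True
      then obtain us vs where ws: "ws = us @ [] # vs" by (meson split_list)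
      then have "word_chain us 0 0" "word_chain vs 1 1"
        using Suc.prems(2) by (auto simp: word_chain_append)
      then have "us = []" "vs = []" using word_chain_refl by blast+
      then show ?thesis using ws by (intro exI[of _ Leaf]) auto
    next
      case False
      then obtain us vs where *: "ws = map ((#) False) us @ map ((#) True) vs"
        "word_chain us 0 1" "word_chain vs 0 1"
        using word_chain_split[of ws 0] Suc.prems by auto
      have "\<forall>w\<in>set us. length w \<le> n" "\<forall>w\<in>set vs. length w \<le> n"
        using Suc.prems(1) unfolding *(1) by (simp_all add: ball_Un)
      then obtain l r where "leaves l = us" "leaves r = vs"
        using Suc.IH * by blast
      then show ?thesis using * by (intro exI[of _ "Node l r"]) simp
    qed
  qed
  then show ?thesis using assms by (metis List.finite_set Max_ge finite_imageI imageI)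
qed

lemma ex_full_tree: "\<exists>T. \<forall>w\<in>set (leaves T). length w = n"
proof (induction n)
  case 0
  show ?case by (rule exI[of _ Leaf]) simp
next
  case (Suc n)
  then obtain T where "\<forall>w\<in>set (leaves T). length w = n" ..
  then show ?case by (intro exI[of _ "Node T T"]) auto
qed

lemma word_chain_image:
  assumes "word_chain us a b" "list_all2 (maps_word f) us xs"
  shows "word_chain xs (f a) (f b)"
  using assms(2,1)
proof (induction arbitrary: a rule: list_all2_induct)
  case (Cons u us x xs)
  then show ?case using maps_word_left[of f u x] maps_word_right[of f u x]
    by simp metis
qed simp

text \<open>Take the full tree of depth \<open>N\<close> as domain. The images of its leaf intervals
  are again adjacent and lead from \<open>f 0 = 0\<close> to \<open>f 1 = 1\<close>, so they are the
  leaf intervals of some tree.\<close>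

lemma ex_tree_diagram:
  assumes "f 0 = 0" "f 1 = 1" and N: "\<And>u. length u = N \<Longrightarrow> \<exists>x. maps_word f u x"
  shows "\<exists>Tp Tm. represents Tp Tm f \<and> (\<forall>w\<in>set (leaves Tp). length w = N)"
proof -
  obtain Tp where Tp: "\<forall>w\<in>set (leaves Tp). length w = N" using ex_full_tree by blast
  obtain X where X: "maps_word f u (X u)" if "length u = N" for u using N by metis
  have all2: "list_all2 (maps_word f) (leaves Tp) (map X (leaves Tp))"
    using Tp X by (auto simp: list_all2_conv_all_nth)
  from word_chain_image[OF word_chain_leaves this]
  obtain Tm where Tm: "leaves Tm = map X (leaves Tp)" using ex_tree_leaves assms by auto
  have "represents Tp Tm f"
    unfolding represents_iff tree_diagram_def Tm using all2 by (auto simp: list_all2_conv_all_nth)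
  then show ?thesis using Tp by blast
qed

section \<open>Descendant leaves and proper colourings of subtrees\<close>

lemma descendant_leaves_Nil: "descendant_leaves T [] = {1..length (leaves T)}"
  by (auto simp: descendant_leaves_def)

lemma all_less_add_iff:
  "(\<forall>i<m + n. P i) \<longleftrightarrow> (\<forall>i<m. P i) \<and> (\<forall>j<n. P (j + m))" for m n :: nat
proof safe
  fix i assume "\<forall>i<m. P i" "\<forall>j<n. P (j + m)" "i < m + n"
  then show "P i" by (cases "i < m") (auto dest: spec[of _ "i - m"])
qed auto

lemma descendant_leaves_eq_image:
  "descendant_leaves T v = Suc ` {i. i < length (leaves T) \<and> prefix v (leaves T ! i)}"
proof (rule Set.set_eqI)
  fix i show "i \<in> descendant_leaves T v \<longleftrightarrow> i \<in> Suc ` {i. i < length (leaves T) \<and> prefix v (leaves T ! i)}"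
    by (cases i) (auto simp: descendant_leaves_def)
qed

lemma leaves_Node_nth:
  "i < length (leaves l) \<Longrightarrow> leaves (Node l r) ! i = False # leaves l ! i"
  "j < length (leaves r) \<Longrightarrow> leaves (Node l r) ! (j + length (leaves l)) = True # leaves r ! j"
  by (simp_all add: nth_append)

lemma ex_less_add_iff:
  "(\<exists>i<m + n. P i) \<longleftrightarrow> (\<exists>i<m. P i) \<or> (\<exists>j<n. P (j + m))" for m n :: nat
  using all_less_add_iff[of m n "\<lambda>i. \<not> P i"] by blast

lemma descendant_leaves_False:
  "descendant_leaves (Node l r) (False # v) = descendant_leaves l v"
proof (rule Set.set_eqI)
  fix k
  have "k \<in> descendant_leaves (Node l r) (False # v) \<longleftrightarrow>
      (\<exists>i<length (leaves l) + length (leaves r).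
        k = Suc i \<and> prefix (False # v) (leaves (Node l r) ! i))"
    by (auto simp: descendant_leaves_eq_image)
  also have "\<dots> \<longleftrightarrow> (\<exists>i<length (leaves l). k = Suc i \<and> prefix v (leaves l ! i))"
    unfolding ex_less_add_iff using leaves_Node_nth by fastforce
  finally show "k \<in> descendant_leaves (Node l r) (False # v) \<longleftrightarrow> k \<in> descendant_leaves l v"
    by (auto simp: descendant_leaves_eq_image)
qed

lemma descendant_leaves_True:
  "descendant_leaves (Node l r) (True # v) = (\<lambda>i. i + length (leaves l)) ` descendant_leaves r v"
proof (rule Set.set_eqI)
  fix k
  have "k \<in> descendant_leaves (Node l r) (True # v) \<longleftrightarrow>
      (\<exists>i<length (leaves l) + length (leaves r).
        k = Suc i \<and> prefix (True # v) (leaves (Node l r) ! i))"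
    by (auto simp: descendant_leaves_eq_image)
  also have "\<dots> \<longleftrightarrow> (\<exists>j<length (leaves r). k = Suc (j + length (leaves l)) \<and> prefix v (leaves r ! j))"
    unfolding ex_less_add_iff using leaves_Node_nth by fastforce
  finally show "k \<in> descendant_leaves (Node l r) (True # v) \<longleftrightarrow>
      k \<in> (\<lambda>i. i + length (leaves l)) ` descendant_leaves r v"
    by (auto simp: descendant_leaves_eq_image)
qed

text \<open>Excludes a degenerate case of \<open>proper_colouring\<close>: the empty set equals
  \<open>{p+1..p}\<close> for every \<open>p\<close> and would demand that \<open>c p\<close> differ
  from itself.\<close>

lemma descendant_leaves_not_empty: "v \<in> vertices T \<Longrightarrow> descendant_leaves T v \<noteq> {}"
proof (induction T arbitrary: v)
  case Leaf
  then show ?case by (simp add: descendant_leaves_Nil)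
next
  case (Node l r)
  then show ?case
    by (auto simp: descendant_leaves_Nil descendant_leaves_False descendant_leaves_True Suc_le_eq)
qed

text \<open>Transfers leaf intervals of a right subtree, with \<open>m\<close> the number of leaves
  of the left one. Nonemptiness makes \<open>p\<close> and \<open>q\<close> unique, and
  \<open>0 \<notin> D\<close> gives \<open>m \<le> p\<close>, so that \<open>p - m\<close> is a true
  difference.\<close>

lemma image_add_eq_interval_iff:
  fixes D :: "nat set"
  assumes "D \<noteq> {}" "0 \<notin> D"
  shows "(\<lambda>i. i + m) ` D = {p+1..q} \<longleftrightarrow> (\<exists>p' q'. p = p' + m \<and> q = q' + m \<and> D = {p'+1..q'})"
proof
  assume eq: "(\<lambda>i. i + m) ` D = {p+1..q}"
  then have "p + 1 \<le> q" using assms(1) by (metis atLeastatMost_empty_iff image_is_empty)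
  then have "p + 1 \<in> (\<lambda>i. i + m) ` D" unfolding eq by simp
  then obtain i where "i \<in> D" "p + 1 = i + m" by (rule imageE)
  then have "m \<le> p" using assms(2) by (cases i) auto
  moreover have "x \<in> D \<longleftrightarrow> p + 1 \<le> x + m \<and> x + m \<le> q" for x
  proof -
    have "x \<in> D \<longleftrightarrow> x + m \<in> (\<lambda>i. i + m) ` D" by auto
    then show ?thesis unfolding eq by simp
  qed
  ultimately have "D = {p - m + 1..q - m}" by (intro Set.set_eqI) (simp, arith)
  then show "\<exists>p' q'. p = p' + m \<and> q = q' + m \<and> D = {p'+1..q'}"
    using \<open>m \<le> p\<close> \<open>p + 1 \<le> q\<close> by (intro exI[of _ "p - m"] exI[of _ "q - m"]) simp
qed auto

lemma proper_colouring_root: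
  "proper_colouring c T (vertices T) \<longleftrightarrow>
     c 0 \<noteq> c (length (leaves T)) \<and> proper_colouring c T (vertices T - {[]})"
proof -
  have "[] \<in> vertices T" by (cases T) auto
  moreover have "{1..length (leaves T)} = {p+1..q} \<longleftrightarrow> p = 0 \<and> q = length (leaves T)" for p q
    using leaves_not_Nil[of T] by (auto simp: Icc_eq_Icc Suc_le_eq simp del: leaves_not_Nil)
  then have "proper_colouring c T {[]} \<longleftrightarrow> c 0 \<noteq> c (length (leaves T))"
    by (auto simp: proper_colouring_def descendant_leaves_Nil)
  moreover have "proper_colouring c T (A \<union> B) \<longleftrightarrow> proper_colouring c T A \<and> proper_colouring c T B" for A B
    by (auto simp: proper_colouring_def)
  moreover have "vertices T = {[]} \<union> (vertices T - {[]})" using \<open>[] \<in> vertices T\<close> by blast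
  ultimately show ?thesis by metis
qed

text \<open>With the root edge ignored, each subtree is coloured like a tree in a strip, its own
  root edge being counted. Planar colourings thus reduce to strip colourings of the two
  subtrees.\<close>

lemma proper_colouring_Node:
  "proper_colouring c (Node l r) (vertices (Node l r) - {[]}) \<longleftrightarrow>
     proper_colouring c l (vertices l) \<and>
     proper_colouring (\<lambda>i. c (i + length (leaves l))) r (vertices r)"
proof -
  have "vertices (Node l r) - {[]} = (#) False ` vertices l \<union> (#) True ` vertices r" by auto
  moreover have "0 \<notin> descendant_leaves r v" for v by (simp add: descendant_leaves_def)
  note right = image_add_eq_interval_iff[OF descendant_leaves_not_empty this]
  have "proper_colouring c (Node l r) ((#) True ` vertices r) \<longleftrightarrow>
      proper_colouring (\<lambda>i. c (i + length (leaves l))) r (vertices r)"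
    unfolding proper_colouring_def ball_simps descendant_leaves_True
    by (rule ball_cong[OF refl], subst right) blast+
  moreover have "proper_colouring c (Node l r) ((#) False ` vertices l) \<longleftrightarrow>
      proper_colouring c l (vertices l)"
    by (simp add: proper_colouring_def descendant_leaves_False)
  ultimately show ?thesis by (simp add: proper_colouring_def ball_Un)
qed

text \<open>Around a caret whose lower edges carry colour differences \<open>x\<close> and \<open>y\<close>, the upper edge
  carries \<open>x + y\<close>. All three are nonzero in \<open>\<int>\<^sub>3\<close> only if \<open>x = y\<close>, and then \<open>x + y = - x\<close>.\<close>
lemma sum_nonzero_mod3: "(x::3) \<noteq> 0 \<Longrightarrow> y \<noteq> 0 \<Longrightarrow> x + y \<noteq> 0 \<Longrightarrow> x = y"
  using exhaust_3[of x] exhaust_3[of y] by auto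

lemma double_mod3: "(x::3) + x = - x"
  using exhaust_3[of x] by auto

text \<open>Explicit form of a strip colouring: the difference is \<open>r\<close> at the root edge
  and changes sign at each caret on the way down to a leaf.\<close>

definition colour_steps :: "(nat \<Rightarrow> 3) \<Rightarrow> btree \<Rightarrow> 3 \<Rightarrow> bool" where
  "colour_steps c T r \<longleftrightarrow>
     (\<forall>i<length (leaves T). c (Suc i) - c i = (- 1) ^ length (leaves T ! i) * r)"

lemma colour_steps_Node:
  "colour_steps c (Node l r) \<rho> \<longleftrightarrow>
     colour_steps c l (- \<rho>) \<and> colour_steps (\<lambda>i. c (i + length (leaves l))) r (- \<rho>)"
  by (simp add: colour_steps_def all_less_add_iff nth_append)

text \<open>The two subtrees contribute \<open>- \<rho>\<close> each, and twice
  \<open>- \<rho>\<close> is \<open>\<rho>\<close> in \<open>\<int>\<^sub>3\<close>.\<close>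

lemma colour_steps_total: "colour_steps c T \<rho> \<Longrightarrow> c (length (leaves T)) - c 0 = \<rho>"
proof (induction T arbitrary: c \<rho>)
  case Leaf
  then show ?case by (simp add: colour_steps_def)
next
  case (Node l r)
  then have "c (length (leaves l)) - c 0 = - \<rho>"
    and "c (length (leaves r) + length (leaves l)) - c (length (leaves l)) = - \<rho>"
    unfolding colour_steps_Node by fastforce+
  then have "c (length (leaves r) + length (leaves l)) - c 0 = - \<rho> + - \<rho>"
    by (metis diff_add_cancel add_diff_eq add.commute)
  then show ?case by (simp only: double_mod3) (simp add: add.commute)
qed

text \<open>By induction the subtrees have nonzero differences \<open>x\<close> and
  \<open>y\<close>. The root edge carries \<open>x + y\<close>, which is nonzero only if
  \<open>x = y\<close>; then \<open>\<rho> = - x\<close> serves the whole tree.\<close>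

lemma proper_colouring_iff_steps:
  "proper_colouring c T (vertices T) \<longleftrightarrow> (\<exists>\<rho>. \<rho> \<noteq> 0 \<and> colour_steps c T \<rho>)"
proof (induction T arbitrary: c)
  case Leaf
  have "proper_colouring c Leaf {}" by (simp add: proper_colouring_def)
  then have "proper_colouring c Leaf (vertices Leaf) \<longleftrightarrow> c 1 - c 0 \<noteq> 0"
    unfolding proper_colouring_root by auto
  moreover have "colour_steps c Leaf \<rho> \<longleftrightarrow> \<rho> = c 1 - c 0" for \<rho>
    by (auto simp: colour_steps_def)
  ultimately show ?case by simp
next
  case (Node l r)
  let ?c = "\<lambda>i. c (i + length (leaves l))"
  have "c 0 \<noteq> c (length (leaves (Node l r))) \<and> (\<exists>x. x \<noteq> 0 \<and> colour_steps c l x) \<and>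
          (\<exists>y. y \<noteq> 0 \<and> colour_steps ?c r y) \<longleftrightarrow>
        (\<exists>\<rho>. \<rho> \<noteq> 0 \<and> colour_steps c l (- \<rho>) \<and> colour_steps ?c r (- \<rho>))"
    (is "?lhs \<longleftrightarrow> ?rhs")
  proof
    assume ?lhs
    then obtain x y where xy: "x \<noteq> 0" "y \<noteq> 0" "colour_steps c l x" "colour_steps ?c r y" by blast
    then have "x = c (length (leaves l)) - c 0"
      "y = c (length (leaves (Node l r))) - c (length (leaves l))"
      using colour_steps_total[of c l] colour_steps_total[of ?c r] by (auto simp: add.commute)
    then have "x + y = c (length (leaves (Node l r))) - c 0" by simp
    moreover have "c 0 \<noteq> c (length (leaves (Node l r)))" using \<open>?lhs\<close> by (rule conjunct1)
    ultimately have "x + y \<noteq> 0" by auto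
    then have "x = y" using xy sum_nonzero_mod3 by blast
    then show ?rhs using xy by (intro exI[of _ "- x"]) auto
  next
    assume ?rhs
    then obtain \<rho> where \<rho>: "\<rho> \<noteq> 0" "colour_steps c (Node l r) \<rho>" by (auto simp: colour_steps_Node)
    then show ?lhs using colour_steps_total[OF \<rho>(2)]
      by (auto simp: colour_steps_Node intro!: exI[of _ "- \<rho>"])
  qed
  then show ?case
    unfolding proper_colouring_root[of c "Node l r"] proper_colouring_Node Node.IH colour_steps_Node .
qed

lemma sign_eq_iff_mod3:
  "\<rho> \<noteq> 0 \<Longrightarrow> (- 1) ^ m * \<rho> = (- 1) ^ n * \<rho> \<longleftrightarrow> even (m + n)" for \<rho> :: 3
  using exhaust_3[of \<rho>] by (cases "even m"; cases "even n") auto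

text \<open>A common colouring has the same total difference on both trees, so they share one
  \<open>\<rho>\<close> and the signs must agree leaf by leaf.\<close>

lemma strip_3_colorable_iff:
  assumes "tree_diagram Tp Tm"
  shows "strip_3_colorable Tp Tm \<longleftrightarrow>
     (\<forall>i<length (leaves Tp). even (length (leaves Tp ! i) + length (leaves Tm ! i)))"
proof
  assume "strip_3_colorable Tp Tm"
  then obtain c \<rho> \<sigma> where c: "\<rho> \<noteq> 0" "colour_steps c Tp \<rho>" "colour_steps c Tm \<sigma>"
    unfolding strip_3_colorable_def proper_colouring_iff_steps by blast
  then have "\<sigma> = \<rho>" using assms colour_steps_total tree_diagram_def by metis
  then show "\<forall>i<length (leaves Tp). even (length (leaves Tp ! i) + length (leaves Tm ! i))"
    using c assms unfolding colour_steps_def tree_diagram_def by (metis sign_eq_iff_mod3)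
next
  assume even: "\<forall>i<length (leaves Tp). even (length (leaves Tp ! i) + length (leaves Tm ! i))"
  \<comment> \<open>Partial sums of the differences prescribed by \<open>Tp\<close> for
    \<open>\<rho> = 1\<close>; equal parities make them fit \<open>Tm\<close> as well.\<close>
  define c :: "nat \<Rightarrow> 3" where "c n = (\<Sum>i<n. (- 1) ^ length (leaves Tp ! i))" for n
  have "colour_steps c Tp 1" "colour_steps c Tm 1"
    using even assms sign_eq_iff_mod3[of 1] by (auto simp: colour_steps_def c_def tree_diagram_def)
  then show "strip_3_colorable Tp Tm"
    unfolding strip_3_colorable_def proper_colouring_iff_steps by (metis zero_neq_one)
qed

text \<open>In a planar colouring the two edges below the root carry opposite colour differences,
  hence the correction for words in the right half.\<close>
definition planar_weight :: "bool list \<Rightarrow> nat" where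
  "planar_weight u = length u + (case u of [] \<Rightarrow> 0 | b # _ \<Rightarrow> of_bool b)"

lemma planar_weight_simps [simp]:
  "planar_weight [] = 0" "planar_weight (b # u) = Suc (length u) + of_bool b"
  by (simp_all add: planar_weight_def)

lemma planar_weight_append: "u \<noteq> [] \<Longrightarrow> planar_weight (u @ w) = planar_weight u + length w"
  by (cases u) auto

text \<open>The outer regions agree in colour, so the differences of the two subtrees add up to 0
  and are opposite; this is the sign built into \<open>planar_weight\<close>. A single leaf is
  excluded because equal outer colours contradict a nonzero difference across it.\<close>

lemma planar_colouring_iff_steps:
  assumes "T \<noteq> Leaf"
  shows "c 0 = c (length (leaves T)) \<and> proper_colouring c T (vertices T - {[]}) \<longleftrightarrow>
     (\<exists>\<rho>. \<rho> \<noteq> 0 \<and>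
       (\<forall>i<length (leaves T). c (Suc i) - c i = (- 1) ^ planar_weight (leaves T ! i) * \<rho>))"
proof -
  obtain l r where T: "T = Node l r" using assms by (cases T) auto
  let ?c = "\<lambda>i. c (i + length (leaves l))"
  have steps: "(\<forall>i<length (leaves T). c (Suc i) - c i = (- 1) ^ planar_weight (leaves T ! i) * \<rho>) \<longleftrightarrow>
      colour_steps c l (- \<rho>) \<and> colour_steps ?c r \<rho>" for \<rho>
    by (simp add: T colour_steps_def all_less_add_iff nth_append)
  have "c 0 = c (length (leaves T)) \<and> (\<exists>x. x \<noteq> 0 \<and> colour_steps c l x) \<and>
          (\<exists>y. y \<noteq> 0 \<and> colour_steps ?c r y) \<longleftrightarrow>
        (\<exists>\<rho>. \<rho> \<noteq> 0 \<and> colour_steps c l (- \<rho>) \<and> colour_steps ?c r \<rho>)"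
    (is "?lhs \<longleftrightarrow> ?rhs")
  proof
    assume ?lhs
    then obtain x y where xy: "x \<noteq> 0" "y \<noteq> 0" "colour_steps c l x" "colour_steps ?c r y" by blast
    then have "x = c (length (leaves l)) - c 0"
      "y = c (length (leaves T)) - c (length (leaves l))"
      using colour_steps_total[of c l] colour_steps_total[of ?c r] by (auto simp: T add.commute)
    then have "x = - y" using \<open>?lhs\<close> by simp
    then show ?rhs using xy by blast
  next
    assume ?rhs
    then obtain \<rho> where \<rho>: "\<rho> \<noteq> 0" "colour_steps c l (- \<rho>)" "colour_steps ?c r \<rho>" by blast
    from colour_steps_total[OF \<rho>(2)] colour_steps_total[OF \<rho>(3)]
    have "c 0 = c (length (leaves T))" by (simp add: T add.commute) (metis diff_eq_eq minus_diff_eq)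
    then show ?lhs using \<rho> by (metis neg_equal_0_iff_equal)
  qed
  then show ?thesis unfolding steps by (simp only: T proper_colouring_Node proper_colouring_iff_steps)
qed

text \<open>The differences \<open>\<rho>\<close> and \<open>\<sigma>\<close> of the two trees are
  nonzero in \<open>\<int>\<^sub>3\<close>, hence equal or opposite. The boolean \<open>b\<close>
  records which, with one value for all leaves.\<close>

lemma planar_3_colorable_iff:
  assumes "tree_diagram Tp Tm" "Tp \<noteq> Leaf" "Tm \<noteq> Leaf"
  shows "planar_3_colorable Tp Tm \<longleftrightarrow>
     (\<exists>b. \<forall>i<length (leaves Tp).
        even (planar_weight (leaves Tp ! i) + planar_weight (leaves Tm ! i)) = b)"
proof -
  have *: "planar_3_colorable Tp Tm \<longleftrightarrow> (\<exists>(c :: nat \<Rightarrow> 3) \<rho> \<sigma>. \<rho> \<noteq> 0 \<and> \<sigma> \<noteq> 0 \<and>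
     (\<forall>i<length (leaves Tp). c (Suc i) - c i = (- 1) ^ planar_weight (leaves Tp ! i) * \<rho>) \<and>
     (\<forall>i<length (leaves Tp). c (Suc i) - c i = (- 1) ^ planar_weight (leaves Tm ! i) * \<sigma>))"
  proof -
    have eq: "length (leaves Tm) = length (leaves Tp)" using assms(1) by (simp add: tree_diagram_def)
    have "planar_3_colorable Tp Tm \<longleftrightarrow>
        (\<exists>c. (c 0 = c (length (leaves Tp)) \<and> proper_colouring c Tp (vertices Tp - {[]})) \<and>
             (c 0 = c (length (leaves Tm)) \<and> proper_colouring c Tm (vertices Tm - {[]})))"
      unfolding planar_3_colorable_def eq by blast
    moreover have "(\<exists>c. (\<exists>\<rho>. \<rho> \<noteq> 0 \<and> P c \<rho>) \<and> (\<exists>\<sigma>. \<sigma> \<noteq> 0 \<and> Q c \<sigma>)) \<longleftrightarrow>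
        (\<exists>c \<rho> \<sigma>. \<rho> \<noteq> 0 \<and> \<sigma> \<noteq> 0 \<and> P c \<rho> \<and> Q c \<sigma>)" for P Q :: "(nat \<Rightarrow> 3) \<Rightarrow> 3 \<Rightarrow> bool"
      by blast
    ultimately show ?thesis
      unfolding planar_colouring_iff_steps[OF assms(2)] planar_colouring_iff_steps[OF assms(3)]
      unfolding eq by (simp only:)
  qed
  have sigma: "\<sigma> = \<rho> \<or> \<sigma> = - \<rho>" if "\<rho> \<noteq> 0" "\<sigma> \<noteq> 0" for \<rho> \<sigma> :: 3
    using exhaust_3[of \<rho>] exhaust_3[of \<sigma>] that by auto
  have odd: "(- 1) ^ m * \<rho> = (- 1) ^ n * - \<rho> \<longleftrightarrow> \<not> even (m + n)" if "\<rho> \<noteq> 0" for m n and \<rho> :: 3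
    using sign_eq_iff_mod3[OF that, of m "Suc n"] by simp
  show ?thesis
  proof
    assume "planar_3_colorable Tp Tm"
    then obtain c :: "nat \<Rightarrow> 3" and \<rho> \<sigma> where c: "\<rho> \<noteq> 0" "\<sigma> \<noteq> 0"
      "\<forall>i<length (leaves Tp). c (Suc i) - c i = (- 1) ^ planar_weight (leaves Tp ! i) * \<rho>"
      "\<forall>i<length (leaves Tp). c (Suc i) - c i = (- 1) ^ planar_weight (leaves Tm ! i) * \<sigma>"
      unfolding * by blast
    note c = c(1,2) c(3,4)[rule_format]
    have "even (planar_weight (leaves Tp ! i) + planar_weight (leaves Tm ! i)) = (\<sigma> = \<rho>)"
      if i: "i < length (leaves Tp)" for i
    proof (cases "\<sigma> = \<rho>")
      case True
      then have "(- 1) ^ planar_weight (leaves Tp ! i) * \<rho> = (- 1) ^ planar_weight (leaves Tm ! i) * \<rho>"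
        using c(3)[OF i] c(4)[OF i] by (simp only:)
      then show ?thesis unfolding sign_eq_iff_mod3[OF c(1)] using True by simp
    next
      case False
      then have "\<sigma> = - \<rho>" using sigma c by blast
      then have "(- 1) ^ planar_weight (leaves Tp ! i) * \<rho> = (- 1) ^ planar_weight (leaves Tm ! i) * - \<rho>"
        using c(3)[OF i] c(4)[OF i] by (simp only:)
      then show ?thesis unfolding odd[OF c(1)] using False by (simp only:)
    qed
    then show "\<exists>b. \<forall>i<length (leaves Tp).
        even (planar_weight (leaves Tp ! i) + planar_weight (leaves Tm ! i)) = b" by blast
  next
    assume "\<exists>b. \<forall>i<length (leaves Tp).
        even (planar_weight (leaves Tp ! i) + planar_weight (leaves Tm ! i)) = b"
    then obtain b where b: "\<And>i. i<length (leaves Tp) \<Longrightarrow>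
        even (planar_weight (leaves Tp ! i) + planar_weight (leaves Tm ! i)) = b" by blast
    define c :: "nat \<Rightarrow> 3" where "c n = (\<Sum>i<n. (- 1) ^ planar_weight (leaves Tp ! i))" for n
    \<comment> \<open>With difference 1 for \<open>Tp\<close>, the parity \<open>b\<close> dictates
      whether \<open>Tm\<close> gets 1 or -1.\<close>
    define \<sigma> :: 3 where "\<sigma> = (if b then 1 else - 1)"
    have "(- 1) ^ planar_weight (leaves Tp ! i) * 1 = (- 1) ^ planar_weight (leaves Tm ! i) * \<sigma>"
      if "i < length (leaves Tp)" for i
      using b[OF that] sign_eq_iff_mod3[of 1] odd[of 1] by (auto simp: \<sigma>_def)
    then have "\<forall>i<length (leaves Tp). c (Suc i) - c i = (- 1) ^ planar_weight (leaves Tp ! i) * 1"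
      "\<forall>i<length (leaves Tp). c (Suc i) - c i = (- 1) ^ planar_weight (leaves Tm ! i) * \<sigma>"
      by (simp_all add: c_def)
    moreover have "\<sigma> \<noteq> 0" "(1::3) \<noteq> 0" by (simp_all add: \<sigma>_def)
    ultimately show "planar_3_colorable Tp Tm" unfolding * by blast
  qed
qed

subsection \<open>Thompson's group\<close>

abbreviation F_carrier where "F_carrier \<equiv> carrier thompson_F"

lemma F_carrier_iff:
  "f \<in> F_carrier \<longleftrightarrow> (\<exists>g. homeomorphism {0..1} {0..1} f g) \<and> dyadic_piecewise_linear f \<and>
     (\<forall>t. t \<notin> {0..1} \<longrightarrow> f t = t)"
  by (simp add: thompson_F_def)

lemma F_carrier_range: "f \<in> F_carrier \<Longrightarrow> t \<in> {0..1} \<Longrightarrow> f t \<in> {0..1}"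
  unfolding F_carrier_iff homeomorphism_def by blast

lemma F_carrier_outside: "f \<in> F_carrier \<Longrightarrow> t \<notin> {0..1} \<Longrightarrow> f t = t"
  unfolding F_carrier_iff by blast

lemma F_carrier_inj: "f \<in> F_carrier \<Longrightarrow> inj_on f {0..1}"
  unfolding F_carrier_iff homeomorphism_def by (metis inj_onI)

lemma F_mult [simp]: "f \<otimes>\<^bsub>thompson_F\<^esub> g = (\<lambda>t. g (f t))"
  by (simp add: thompson_F_def)

lemma F_one [simp]: "\<one>\<^bsub>thompson_F\<^esub> = (\<lambda>t. t)"
  by (simp add: thompson_F_def)

section \<open>Dyadic rationals and linear pieces\<close>

lemma dyadic_of_int [simp]: "of_int a \<in> dyadic_rationals"
  unfolding dyadic_rationals_def by (rule CollectI, rule exI[of _ a], rule exI[of _ 0]) simp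

lemma dyadic_0 [simp]: "0 \<in> dyadic_rationals"
  using dyadic_of_int[of 0] by simp

lemma dyadic_divide_power: "of_int a / 2 ^ n \<in> dyadic_rationals"
  unfolding dyadic_rationals_def by blast

lemma dyadic_add:
  assumes "x \<in> dyadic_rationals" "y \<in> dyadic_rationals" shows "x + y \<in> dyadic_rationals"
proof -
  obtain a b m n where "x = of_int a / 2 ^ n" "y = of_int b / 2 ^ m"
    using assms unfolding dyadic_rationals_def by blast
  then have "x + y = of_int (a * 2 ^ m + b * 2 ^ n) / 2 ^ (n + m)"
    by (simp add: add_divide_distrib power_add)
  then show ?thesis using dyadic_divide_power by metis
qed

lemma dyadic_powi_mult:
  assumes "x \<in> dyadic_rationals" shows "2 powi k * x \<in> dyadic_rationals"
proof -
  obtain a n where x: "x = of_int a / 2 ^ n" using assms unfolding dyadic_rationals_def by blast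
  show ?thesis
  proof (cases "0 \<le> k")
    case True
    then have "2 powi k * x = of_int (a * 2 ^ nat k) / 2 ^ n" by (simp add: x power_int_def)
    then show ?thesis using dyadic_divide_power by metis
  next
    case False
    then have "2 powi k * x = of_int a / 2 ^ (n + nat (- k))"
      by (simp add: x power_int_def power_add field_simps)
    then show ?thesis using dyadic_divide_power by metis
  qed
qed

lemma dyadic_common_denominator:
  assumes "finite D" "D \<subseteq> dyadic_rationals"
  shows "\<exists>M. \<forall>x\<in>D. \<exists>a. x = of_int a / 2 ^ M"
  using assms
proof (induction D rule: finite_induct)
  case (insert y D)
  then obtain M where M: "\<forall>x\<in>D. \<exists>a. x = of_int a / 2 ^ M" by auto
  obtain b n where y: "y = of_int b / 2 ^ n" using insert.prems unfolding dyadic_rationals_def by auto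
  have "\<exists>a. x = of_int a / 2 ^ (M + n)" if "x \<in> insert y D" for x
  proof (cases "x = y")
    case True
    then show ?thesis using y by (intro exI[of _ "b * 2 ^ M"]) (simp add: power_add)
  next
    case False
    then have "x \<in> D" using that by simp
    from bspec[OF M this] obtain a where "x = of_int a / 2 ^ M" ..
    then show ?thesis by (intro exI[of _ "a * 2 ^ n"]) (simp add: power_add)
  qed
  then show ?case by blast
qed simp

text \<open>\<open>2 ^ M\<close> is a common denominator of the break points, so no break point lies
  inside the interval of a word of length \<open>M\<close>.\<close>

lemma affine_on_words:
  assumes "dyadic_piecewise_linear f"
  shows "\<exists>M. \<forall>u. length u = M \<longrightarrow> (\<exists>(k::int) (d::real).
     \<forall>t\<in>{word_left u..word_left u + 1 / 2 ^ length u}. f t = 2 powi k * t + d)"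
proof -
  obtain D where D: "finite D" "D \<subseteq> dyadic_rationals \<inter> {0..1}" "{0, 1} \<subseteq> D"
    and "\<forall>a\<in>D. \<forall>b\<in>D. a < b \<and> {a<..<b} \<inter> D = {} \<longrightarrow>
      (\<exists>(k::int) (d::real). \<forall>t\<in>{a..b}. f t = 2 powi k * t + d)"
    using assms unfolding dyadic_piecewise_linear_def by (elim exE conjE) (rule that)
  note affine = this(4)[rule_format, OF _ _ conjI]
  obtain M where M: "\<forall>x\<in>D. \<exists>a. x = of_int a / 2 ^ M"
    using dyadic_common_denominator[of D] D by auto
  have "\<exists>(k::int) (d::real). \<forall>t\<in>{word_left u..word_left u + 1 / 2 ^ length u}. f t = 2 powi k * t + d"
    if u: "length u = M" for u
  proof -
    obtain j where j: "word_left u = real j / 2 ^ M" using word_left_dyadic[of u] u by auto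
    \<comment> \<open>The last break point up to \<open>word_left u\<close> and the first one after
      it are consecutive, so \<open>f\<close> is affine between them.\<close>
    define A where "A = {x\<in>D. x \<le> word_left u}"
    define B where "B = {x\<in>D. word_left u < x}"
    have fin: "finite A" "finite B" using D(1) by (simp_all add: A_def B_def)
    have "0 \<in> A" using D(3) word_left_bounds(1) by (simp add: A_def)
    then have maxA: "Max A \<in> A" using Max_in fin by blast
    have "1 \<in> B" using D(3) word_left_less_1 by (simp add: B_def)
    then have minB: "Min B \<in> B" using Min_in fin by blast
    have "{Max A<..<Min B} \<inter> D = {}"
    proof (rule ccontr)
      assume "{Max A<..<Min B} \<inter> D \<noteq> {}"
      then obtain x where x: "x \<in> D" "Max A < x" "x < Min B" by auto
      show False
      proof (cases "x \<le> word_left u")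
        case True
        then have "x \<in> A" using x by (simp add: A_def)
        then show False using x Max_ge[of A x] fin by linarith
      next
        case False
        then have "x \<in> B" using x by (simp add: B_def)
        then show False using x Min_le[of B x] fin by linarith
      qed
    qed
    moreover have AB: "Max A \<in> D" "Max A \<le> word_left u" "Min B \<in> D" "word_left u < Min B"
      using maxA minB by (auto simp: A_def B_def)
    ultimately obtain k d where kd: "\<forall>t\<in>{Max A..Min B}. f t = 2 powi k * t + d"
      using affine[of "Max A" "Min B"] by auto
    obtain b where b: "Min B = of_int b / 2 ^ M" using M AB by blast
    then have "real j < of_int b" using AB(4) j by (simp add: divide_less_cancel)
    then have "real j + 1 \<le> of_int b" using int_less_real_le[of "int j" b] by simp
    then have "word_left u + 1 / 2 ^ length u \<le> Min B"
      unfolding b j u by (simp add: add_divide_distrib[symmetric] divide_right_mono)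
    then show ?thesis using kd AB(2) by (intro exI[of _ k] exI[of _ d]) auto
  qed
  then show ?thesis by blast
qed

text \<open>A continuous injection of an interval is monotone; the positive slope near 0 rules out
  the decreasing case.\<close>

lemma F_carrier_endpoints:
  assumes "f \<in> F_carrier"
  shows "f 0 = 0" "f 1 = 1" "strict_mono_on {0..1} f"
proof -
  obtain g where hom: "homeomorphism {0..1} {0..1} f g" using assms F_carrier_iff by blast
  then have cont: "continuous_on {0..1} f" and surj: "f ` {0..1} = {0..1}"
    by (auto simp: homeomorphism_def)
  have inj: "inj_on f {0..1}" using assms by (rule F_carrier_inj)
  have between: "(f 0 < f x \<and> f x < f 1) \<or> (f 1 < f x \<and> f x < f 0)" if "0 < x" "x < 1" for x
    using continuous_inj_imp_mono[OF that cont inj] .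
  obtain M where M: "\<And>u. length u = M \<Longrightarrow> \<exists>(k::int) (d::real).
     \<forall>t\<in>{word_left u..word_left u + 1 / 2 ^ length u}. f t = 2 powi k * t + d"
    using affine_on_words assms F_carrier_iff by blast
  obtain k d where kd: "\<And>t. t \<in> {0..1 / 2 ^ M} \<Longrightarrow> f t = 2 powi k * t + d"
    using M[of "replicate M False"] by auto
  \<comment> \<open>Half the length of the first affine interval, so that \<open>e < 1\<close> even
    when \<open>M = 0\<close>, as strict betweenness requires.\<close>
  define e :: real where "e = 1 / 2 ^ Suc M"
  have e: "0 < e" "e \<le> 1 / 2 ^ M" "e < 1"
    by (simp_all add: e_def field_simps) (metis one_less_power one_less_numeral_iff semiring_norm(76) zero_less_Suc power_Suc)
  have "f 0 < f e" using kd[of 0] kd[of e] e by simp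
  then have lt: "f 0 < f 1" using between[of e] e by linarith
  have between': "f 0 < f x \<and> f x < f 1" if "0 < x" "x < 1" for x
    using between[OF that] lt by linarith
  have ge: "f 0 \<le> f x" "f x \<le> f 1" if "x \<in> {0..1}" for x
    using between'[of x] that lt by (cases "x = 0"; cases "x = 1"; force)+
  have "0 \<in> f ` {0..1}" "1 \<in> f ` {0..1}" unfolding surj by auto
  then obtain y z where "y \<in> {0..1}" "0 = f y" "z \<in> {0..1}" "1 = f z" by (elim imageE)
  then have "f 0 \<le> 0" "1 \<le> f 1" using ge(1)[of y] ge(2)[of z] by linarith+
  moreover have "f 0 \<in> {0..1}" "f 1 \<in> {0..1}" using F_carrier_range[OF assms] by auto
  ultimately show f01: "f 0 = 0" "f 1 = 1" by auto
  show "strict_mono_on {0..1} f"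
  proof (rule strict_mono_onI)
    fix x y :: real assume xy: "x \<in> {0..1}" "y \<in> {0..1}" "x < y"
    show "f x < f y"
    proof (cases "x = 0")
      case True
      then show ?thesis using xy between'[of y] lt by (cases "y = 1") auto
    next
      case False
      have "(f 0 < f x \<and> f x < f y) \<or> (f y < f x \<and> f x < f 0)"
        by (rule continuous_inj_imp_mono)
           (use False xy in \<open>auto intro!: continuous_on_subset[OF cont] inj_on_subset[OF inj]\<close>)
      then show ?thesis using ge(1)[OF xy(1)] by linarith
    qed
  qed
qed

text \<open>Induction along the grid: starting at \<open>f 0 = 0\<close>, each step adds a power of
  2 times \<open>1 / 2 ^ M\<close>.\<close>

lemma F_carrier_dyadic:
  assumes f: "f \<in> F_carrier"
    and affine: "\<And>u. length u = M \<Longrightarrow> \<exists>(k::int) (d::real).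
      \<forall>t\<in>{word_left u..word_left u + 1 / 2 ^ length u}. f t = 2 powi k * t + d"
    and "j \<le> 2 ^ M"
  shows "f (real j / 2 ^ M) \<in> dyadic_rationals"
  using assms(3)
proof (induction j)
  case 0
  then show ?case using F_carrier_endpoints(1)[OF f] by simp
next
  case (Suc j)
  then obtain u where u: "length u = M" "word_left u = real j / 2 ^ M"
    using ex_word[of j M] by auto
  obtain k d where kd: "\<And>t. t \<in> {word_left u..word_left u + 1 / 2 ^ M} \<Longrightarrow> f t = 2 powi k * t + d"
    using affine[OF u(1)] u(1) by auto
  have "f (real (Suc j) / 2 ^ M) = f (real j / 2 ^ M) + 2 powi k * (1 / 2 ^ M)"
    using kd[of "real j / 2 ^ M"] kd[of "real (Suc j) / 2 ^ M"]
    by (simp add: u(2) add_divide_distrib algebra_simps)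
  moreover have "1 / 2 ^ M \<in> dyadic_rationals" using dyadic_divide_power[of 1 M] by simp
  ultimately show ?case
    using dyadic_add[OF Suc.IH dyadic_powi_mult[of "1 / 2 ^ M" k]] Suc.prems by simp
qed

text \<open>Once the image of a subinterval is short compared with the denominator of the image of
  its left end point, it is a standard dyadic interval.\<close>
lemma affine_imp_maps_word:
  assumes affine: "\<And>t. t \<in> {word_left u..word_left u + 1 / 2 ^ length u} \<Longrightarrow> f t = 2 powi k * t + d"
    and dyadic: "f (word_left u) \<in> dyadic_rationals"
    and range: "\<And>t. t \<in> {0..<1} \<Longrightarrow> f t \<in> {0..<1}"
  shows "\<exists>q. \<forall>w. length w = q \<longrightarrow> (\<exists>x. maps_word f (u @ w) x)"
proof -
  obtain A P where A: "f (word_left u) = of_int A / 2 ^ P"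
    using dyadic unfolding dyadic_rationals_def by blast
  \<comment> \<open>After \<open>q\<close> more letters the image has length
    \<open>1 / 2 ^ L\<close>. The choice of \<open>q\<close> forces \<open>P \<le> L\<close>, so the
    image of every left end point is a multiple of \<open>1 / 2 ^ L\<close>.\<close>
  define q where "q = P + nat k"
  define L where "L = nat (int (length u) + int q - k)"
  have L: "int L = int (length u) + int q - k" "P \<le> L" by (auto simp: L_def q_def)
  have scale: "2 powi k / 2 ^ (length u + q) = (1 / 2 ^ L :: real)"
  proof -
    have "(2 powi k :: real) * 2 ^ L = 2 powi (k + int L)"
      by (simp add: power_int_add)
    also have "k + int L = int (length u + q)" by (simp add: L)
    finally have "(2 powi k :: real) * 2 ^ L = 2 ^ (length u + q)" by (simp only: power_int_of_nat)
    then show ?thesis by (simp add: divide_simps mult.commute)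
  qed
  have "\<exists>x. maps_word f (u @ w) x" if w: "length w = q" for w
  proof -
    obtain i where i: "word_left w = real i / 2 ^ q" using word_left_dyadic[of w] w by auto
    have f_at: "f (word_left (u @ w) + r / 2 ^ length (u @ w)) =
        of_int A / 2 ^ P + (real i + r) / 2 ^ L" if r: "r \<in> {0..1}" for r
    proof -
      define s where "s = word_left w + r / 2 ^ length w"
      have s: "0 \<le> s" "s \<le> 1" using word_interval_subset[OF r, of w] by (auto simp: s_def)
      have eq: "word_left (u @ w) + r / 2 ^ length (u @ w) = word_left u + s / 2 ^ length u"
        by (simp add: s_def word_left_append power_add field_simps)
      have "f (word_left u + s / 2 ^ length u) = f (word_left u) + 2 powi k * (s / 2 ^ length u)"
        using affine[of "word_left u"] affine[of "word_left u + s / 2 ^ length u"] s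
        by (simp add: algebra_simps divide_right_mono)
      also have "2 powi k * (s / 2 ^ length u) = (real i + r) * (2 powi k / 2 ^ (length u + q))"
        by (simp add: s_def i w power_add field_simps)
      finally show ?thesis unfolding eq A scale by simp
    qed
    define n where "n = A * 2 ^ (L - P) + int i"
    have n: "of_int A / 2 ^ P + real i / 2 ^ L = of_int n / 2 ^ L"
    proof -
      obtain R where "L = P + R" using L(2) le_Suc_ex by blast
      then show ?thesis by (simp add: n_def add_divide_distrib power_add)
    qed
    \<comment> \<open>The half-open range matters: it gives \<open>n < 2 ^ L\<close>, so that
      \<open>n / 2 ^ L\<close> is the left end point of the interval of a word.\<close>
    have "f (word_left (u @ w)) \<in> {0..<1}"
      by (rule range) (use word_left_bounds(1)[of "u @ w"] word_left_less_1[of "u @ w"] in auto)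
    moreover have "of_int n = f (word_left (u @ w)) * 2 ^ L" using f_at[of 0] n by simp
    ultimately have "0 \<le> (of_int n :: real)" "(of_int n :: real) < 2 ^ L" by simp_all
    then have "0 \<le> n" "real (nat n) < 2 ^ L" by simp_all
    then have "nat n < 2 ^ L" by simp
    then obtain x where x: "length x = L" "word_left x = real (nat n) / 2 ^ L" using ex_word by blast
    have "maps_word f (u @ w) x"
      unfolding maps_word_def
    proof
      fix r :: real assume "r \<in> {0..1}"
      from f_at[OF this] show "f (word_left (u @ w) + r / 2 ^ length (u @ w)) = word_left x + r / 2 ^ length x"
        using n x \<open>0 \<le> n\<close> by (simp add: add_divide_distrib)
    qed
    then show ?thesis ..
  qed
  then show ?thesis by blast
qed

text \<open>Each of the finitely many words of length \<open>M\<close> needs some number of extra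
  letters, and the maximum of these numbers serves all. The image is required to be nonempty because
  planar weights depend on its first letter.\<close>

lemma F_carrier_maps_word:
  assumes f: "f \<in> F_carrier"
  shows "\<exists>N. \<forall>u. N \<le> length u \<longrightarrow> (\<exists>x. x \<noteq> [] \<and> maps_word f u x)"
proof -
  obtain M where affine: "\<And>u. length u = M \<Longrightarrow> \<exists>(k::int) (d::real).
     \<forall>t\<in>{word_left u..word_left u + 1 / 2 ^ length u}. f t = 2 powi k * t + d"
    using affine_on_words f F_carrier_iff by blast
  have range: "f t \<in> {0..<1}" if "t \<in> {0..<1}" for t
    using F_carrier_range[OF f, of t] F_carrier_endpoints[OF f] that
      strict_mono_onD[OF F_carrier_endpoints(3)[OF f], of t 1] by auto
  have "\<exists>q. \<forall>w. length w = q \<longrightarrow> (\<exists>x. maps_word f (u @ w) x)" if u: "length u = M" for u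
  proof -
    obtain k d where "\<And>t. t \<in> {word_left u..word_left u + 1 / 2 ^ length u} \<Longrightarrow> f t = 2 powi k * t + d"
      using affine[OF u] by auto
    moreover obtain j where "j < 2 ^ M" "word_left u = real j / 2 ^ M"
      using word_left_dyadic[of u] u by auto
    then have "f (word_left u) \<in> dyadic_rationals"
      using F_carrier_dyadic[OF f affine, of M j] by simp
    ultimately show ?thesis using affine_imp_maps_word range by blast
  qed
  then obtain q where q: "\<And>u w. length u = M \<Longrightarrow> length w = q u \<Longrightarrow> \<exists>x. maps_word f (u @ w) x"
    by metis
  define Q where "Q = Max (q ` {u. length u = M})"
  have fin: "finite (q ` {u. length u = M})"
    using finite_lists_length_eq[of "UNIV :: bool set" M] by simp
  \<comment> \<open>One letter beyond \<open>M + Q\<close> leaves a nonempty suffix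
    \<open>v\<close>, which makes the image word nonempty.\<close>
  have "\<exists>x. x \<noteq> [] \<and> maps_word f u x" if u: "Suc (M + Q) \<le> length u" for u
  proof -
    define u1 where "u1 = take M u"
    have u1: "length u1 = M" "u = u1 @ drop M u" using u by (auto simp: u1_def)
    then have "q u1 \<le> Q" unfolding Q_def using fin by (intro Max_ge) auto
    define w where "w = take (q u1) (drop M u)"
    define v where "v = drop (q u1) (drop M u)"
    have "u = (u1 @ w) @ v"
      unfolding append_assoc w_def v_def append_take_drop_id by (rule u1(2))
    moreover have "length w = q u1" "v \<noteq> []"
      using u1(1) u \<open>q u1 \<le> Q\<close> by (auto simp: w_def v_def)
    moreover obtain x where "maps_word f (u1 @ w) x" using q[OF u1(1) \<open>length w = q u1\<close>] ..
    ultimately have "maps_word f u (x @ v)" "x @ v \<noteq> []"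
      using maps_word_append[of f "u1 @ w" x v] by auto
    then show ?thesis by blast
  qed
  then show ?thesis by blast
qed

lemma F_carrier_tree_diagram:
  assumes "f \<in> F_carrier"
  shows "\<exists>Tp Tm. represents Tp Tm f \<and> Tp \<noteq> Leaf \<and> Tm \<noteq> Leaf"
proof -
  obtain N where N: "\<And>u. N \<le> length u \<Longrightarrow> \<exists>x. x \<noteq> [] \<and> maps_word f u x"
    using F_carrier_maps_word[OF assms] by blast
  then have "\<exists>x. maps_word f u x" if "length u = Suc N" for u using that by (metis Suc_n_not_le_n nat_le_linear)
  then obtain Tp Tm where T: "represents Tp Tm f" "\<forall>w\<in>set (leaves Tp). length w = Suc N"
    using ex_tree_diagram[OF F_carrier_endpoints(1,2)[OF assms], of "Suc N"] by blast
  then have Tp: "Tp \<noteq> Leaf" by auto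
  then have "Tm \<noteq> Leaf"
    using T(1) by (simp add: represents_def tree_diagram_def flip: length_leaves_eq_1)
  then show ?thesis using T Tp by blast
qed

text \<open>The multiples of \<open>1 / 2 ^ N\<close> serve as break points: neighbouring ones bound
  the interval of a word of length \<open>N\<close>.\<close>

lemma dyadic_piecewise_linear_words:
  assumes N: "\<forall>u. length u = N \<longrightarrow> (\<exists>x. maps_word f u x)"
  shows "dyadic_piecewise_linear f"
proof -
  define D :: "real set" where "D = (\<lambda>j. real j / 2 ^ N) ` {..2 ^ N}"
  have "finite D" by (simp add: D_def)
  moreover have "D \<subseteq> dyadic_rationals \<inter> {0..1}"
  proof -
    have "real j / 2 ^ N \<in> dyadic_rationals" for j using dyadic_divide_power[of "int j" N] by simp
    then show ?thesis by (auto simp: D_def field_simps)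
  qed
  moreover have "{0, 1} \<subseteq> D" by (auto simp: D_def image_iff intro: bexI[of _ 0] bexI[of _ "2 ^ N"])
  moreover have affine: "\<exists>(k::int) (d::real). \<forall>t\<in>{a..b}. f t = 2 powi k * t + d"
    if ab: "a \<in> D" "b \<in> D" "a < b" "{a<..<b} \<inter> D = {}" for a b
  proof -
    obtain i j where ij: "a = real i / 2 ^ N" "b = real j / 2 ^ N" "j \<le> 2 ^ N"
      using ab by (auto simp: D_def)
    then have "i < j" using ab(3) by (simp add: divide_less_cancel)
    have "real (Suc i) / 2 ^ N \<in> D" using \<open>i < j\<close> ij(3) unfolding D_def by (intro imageI) simp
    moreover have "a < real (Suc i) / 2 ^ N" by (simp add: ij divide_strict_right_mono)
    ultimately have "\<not> real (Suc i) / 2 ^ N < b" using ab(4) by auto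
    then have "j = Suc i" using \<open>i < j\<close> by (simp add: ij divide_less_cancel)
    moreover obtain u where u: "length u = N" "word_left u = real i / 2 ^ N"
      using ex_word[of i N] \<open>i < j\<close> ij(3) by auto
    ultimately have "{a..b} = {word_left u..word_left u + 1 / 2 ^ length u}"
      by (simp add: ij add_divide_distrib)
    moreover obtain x where "maps_word f u x" using N u by blast
    ultimately show ?thesis using maps_word_affine by blast
  qed
  moreover have "\<forall>a\<in>D. \<forall>b\<in>D. a < b \<and> {a<..<b} \<inter> D = {} \<longrightarrow>
      (\<exists>(k::int) (d::real). \<forall>t\<in>{a..b}. f t = 2 powi k * t + d)"
    by (intro ballI impI, elim conjE) (rule affine)
  ultimately show ?thesis unfolding dyadic_piecewise_linear_def by (intro exI[of _ D] conjI)
qed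

lemma F_carrierI:
  assumes "homeomorphism {0..1} {0..1} f g" "\<forall>u. length u = N \<longrightarrow> (\<exists>x. maps_word f u x)"
    "\<And>t. t \<notin> {0..1} \<Longrightarrow> f t = t"
  shows "f \<in> F_carrier"
  using assms dyadic_piecewise_linear_words F_carrier_iff by metis

section \<open>The group structure\<close>

lemma F_carrier_ident: "(\<lambda>t. t) \<in> F_carrier"
  by (rule F_carrierI[of _ "\<lambda>t. t" 0]) (auto intro: homeomorphism_ident maps_word_ident)

lemma F_carrier_comp:
  assumes f: "f \<in> F_carrier" and g: "g \<in> F_carrier" shows "(\<lambda>t. g (f t)) \<in> F_carrier"
proof -
  obtain f' g' where "homeomorphism {0..1} {0..1} f f'" "homeomorphism {0..1} {0..1} g g'"
    using assms F_carrier_iff by blast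
  then have "homeomorphism {0..1} {0..1} (g \<circ> f) (f' \<circ> g')" by (rule homeomorphism_compose)
  then have hom: "homeomorphism {0..1} {0..1} (\<lambda>t. g (f t)) (f' \<circ> g')" by (simp add: comp_def)
  obtain N where N: "\<And>u. N \<le> length u \<Longrightarrow> \<exists>x. x \<noteq> [] \<and> maps_word f u x"
    using F_carrier_maps_word[OF f] by blast
  obtain M where M: "\<And>u. M \<le> length u \<Longrightarrow> \<exists>x. x \<noteq> [] \<and> maps_word g u x"
    using F_carrier_maps_word[OF g] by blast
  \<comment> \<open>The first \<open>N\<close> letters suffice for \<open>f\<close>; the other
    \<open>M\<close> are carried over unchanged and make the image long enough for
    \<open>g\<close>.\<close>
  have "\<exists>x. maps_word (\<lambda>t. g (f t)) u x" if u: "length u = N + M" for u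
  proof -
    obtain x where "maps_word f (take N u) x" using N[of "take N u"] u by auto
    then have x: "maps_word f u (x @ drop N u)"
      using maps_word_append[of f "take N u" x "drop N u"] by simp
    obtain y where "maps_word g (x @ drop N u) y" using M[of "x @ drop N u"] u by auto
    then show ?thesis using x maps_word_comp by blast
  qed
  then show ?thesis
    by (intro F_carrierI[OF hom, of "N + M"]) (auto simp: F_carrier_outside[OF f] F_carrier_outside[OF g])
qed

lemma F_carrier_inverse:
  assumes f: "f \<in> F_carrier"
  shows "\<exists>g\<in>F_carrier. (\<forall>t. g (f t) = t) \<and> (\<forall>t. f (g t) = t)"
proof -
  obtain h where h: "homeomorphism {0..1} {0..1} f h" using f F_carrier_iff by blast
  define g where "g t = (if t \<in> {0..1} then h t else t)" for t
  have "homeomorphism {0..1} {0..1} h f" using h by (rule homeomorphism_symD)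
  then have hom: "homeomorphism {0..1} {0..1} g f"
    by (rule homeomorphism_cong) (auto simp: g_def)
  have gf: "g (f t) = t" for t
    using h F_carrier_range[OF f, of t] F_carrier_outside[OF f, of t]
    by (auto simp: g_def homeomorphism_def)
  have fg: "f (g t) = t" for t
    using h F_carrier_outside[OF f, of t] by (auto simp: g_def homeomorphism_def)
  obtain Tp Tm where T: "represents Tp Tm f" using F_carrier_tree_diagram[OF f] by blast
  \<comment> \<open>\<open>N\<close> bounds the depth of \<open>Tm\<close>, so each word of length
    \<open>N\<close> extends a leaf of \<open>Tm\<close>, where the inverse branch is known.\<close>
  define N where "N = Max (length ` set (leaves Tm))"
  have "\<exists>x. maps_word g u x" if u: "length u = N" for u
  proof -
    obtain i where i: "i < length (leaves Tm)"
      "prefix u (leaves Tm ! i) \<or> prefix (leaves Tm ! i) u" using leaf_comparable by blast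
    then have "length (leaves Tm ! i) \<le> length u" unfolding u N_def by (intro Max_ge) auto
    then have "prefix (leaves Tm ! i) u"
      using i(2) prefix_length_prefix[of "leaves Tm ! i" "leaves Tm ! i" u] by auto
    then obtain w where w: "u = leaves Tm ! i @ w" by (auto simp: prefix_def)
    have "maps_word f (leaves Tp ! i) (leaves Tm ! i)"
      using T i(1) by (simp add: represents_iff tree_diagram_def)
    then have "maps_word g (leaves Tm ! i) (leaves Tp ! i)" using gf by (rule maps_word_inverse)
    then show ?thesis unfolding w using maps_word_append by blast
  qed
  then have "g \<in> F_carrier" by (intro F_carrierI[OF hom, of N]) (auto simp: g_def)
  then show ?thesis using gf fg by blast
qed

lemma group_thompson_F: "group thompson_F"
proof (rule groupI)
  fix f assume "f \<in> F_carrier"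
  then show "\<exists>g\<in>F_carrier. g \<otimes>\<^bsub>thompson_F\<^esub> f = \<one>\<^bsub>thompson_F\<^esub>"
    using F_carrier_inverse[of f] by fastforce
qed (auto simp: F_carrier_comp F_carrier_ident)

lemma F_inv_apply:
  assumes "f \<in> F_carrier"
  shows "(inv\<^bsub>thompson_F\<^esub> f) (f t) = t" "f ((inv\<^bsub>thompson_F\<^esub> f) t) = t"
  using group.r_inv[OF group_thompson_F assms] group.l_inv[OF group_thompson_F assms]
  by (simp_all add: fun_eq_iff)

subsection \<open>Colourable elements as parity conditions\<close>

lemma has_derivative_maps_word:
  assumes "maps_word f u x" "a \<in> {0..1}"
    and "\<And>t. t \<in> {0..1} \<Longrightarrow> dist t a < 1 / 2 ^ length u \<Longrightarrow>
           t \<in> {word_left u..word_left u + 1 / 2 ^ length u}"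
  shows "(f has_real_derivative 2 powi (int (length u) - int (length x))) (at a within {0..1})"
proof -
  define c :: real where "c = 2 powi (int (length u) - int (length x))"
  have "((\<lambda>t. c * t + (word_left x - c * word_left u)) has_real_derivative c) (at a within {0..1})"
    by (auto intro!: derivative_eq_intros)
  then show ?thesis unfolding c_def[symmetric]
    by (rule has_field_derivative_transform_within[where d = "1 / 2 ^ length u"])
       (use assms maps_word_affine[OF assms(1)] in \<open>auto simp: c_def\<close>)
qed

text \<open>Membership in \<open>K22\<close> only asserts that some derivatives have even logarithm;
  uniqueness identifies them with the slopes computed from words.\<close>

lemma has_real_derivative_unique_unit:
  assumes "(f has_real_derivative c) (at a within {0..1})"
    "(f has_real_derivative d) (at a within {0..1})" "a \<in> {0..1}"
  shows "c = d"
  using vector_derivative_unique_within_closed_interval[of 0 1 a f c d] assms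
  by (simp add: has_real_derivative_iff_has_vector_derivative)

lemma log_two_powi: "log 2 (2 powi k) = of_int k"
  by (simp add: powr_real_of_int'[symmetric])

lemma ex_double_iff_even: "(\<exists>m::int. real_of_int k = 2 * of_int m) \<longleftrightarrow> even k"
proof -
  have "real_of_int k = 2 * of_int m \<longleftrightarrow> k = 2 * m" for m :: int
    by (metis of_int_eq_iff of_int_mult of_int_numeral)
  then show ?thesis by (auto elim: evenE)
qed

lemma K22_iff:
  assumes f: "f \<in> F_carrier"
    and u: "maps_word f u x" "word_left u = 0"
    and v: "maps_word f v y" "word_left v + 1 / 2 ^ length v = 1"
  shows "f \<in> K22 \<longleftrightarrow> even (length u + length x) \<and> even (length v + length y)"
proof -
  define a :: real where "a = 2 powi (int (length u) - int (length x))"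
  define b :: real where "b = 2 powi (int (length v) - int (length y))"
  have a: "(f has_real_derivative a) (at 0 within {0..1})"
    unfolding a_def by (rule has_derivative_maps_word[OF u(1)]) (auto simp: u(2) dist_real_def)
  have b: "(f has_real_derivative b) (at 1 within {0..1})"
    unfolding b_def
    by (rule has_derivative_maps_word[OF v(1)]) (use v(2) in \<open>auto simp: dist_real_def\<close>)
  have "f \<in> K22 \<longleftrightarrow> (\<exists>k::int. log 2 a = 2 * of_int k) \<and> (\<exists>l::int. log 2 b = 2 * of_int l)"
    (is "_ \<longleftrightarrow> ?even")
  proof
    assume "f \<in> K22"
    then obtain c d where cd: "(f has_real_derivative c) (at 0 within {0..1})"
      "(f has_real_derivative d) (at 1 within {0..1})"
      "\<exists>k::int. log 2 c = 2 * of_int k" "\<exists>l::int. log 2 d = 2 * of_int l"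
      unfolding K22_def mem_Collect_eq by (elim exE conjE) (rule that; blast)
    have "c = a" "d = b"
      using has_real_derivative_unique_unit[OF cd(1) a] has_real_derivative_unique_unit[OF cd(2) b] by simp_all
    then show ?even using cd(3,4) by simp
  next
    assume ?even
    then show "f \<in> K22" unfolding K22_def mem_Collect_eq by (intro conjI exI[of _ a] exI[of _ b] f a b; elim conjE)
  qed
  also have "\<dots> \<longleftrightarrow> even (length u + length x) \<and> even (length v + length y)"
    unfolding a_def b_def log_two_powi ex_double_iff_even by (simp add: even_diff_iff)
  finally show ?thesis .
qed

lemma word_left_replicate_True: "word_left (replicate n True) = 1 - 1 / 2 ^ n"
  by (induction n) (auto simp: field_simps)

lemma word_right_eq_1: "word_left u + 1 / 2 ^ length u = 1 \<Longrightarrow> u = replicate (length u) True"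
  using word_left_eq_iff[of u "replicate (length u) True"] word_left_replicate_True[of "length u"]
  by simp

lemma planar_weight_left: "word_left u = 0 \<Longrightarrow> planar_weight u = length u"
  using word_left_eq_0[of u] by (cases u) auto

lemma planar_weight_right:
  "word_left u + 1 / 2 ^ length u = 1 \<Longrightarrow> u \<noteq> [] \<Longrightarrow> planar_weight u = Suc (length u)"
  using word_right_eq_1[of u] by (cases u) auto

section \<open>Parities of mapped words\<close>

lemma leaf_not_Nil: "T \<noteq> Leaf \<Longrightarrow> i < length (leaves T) \<Longrightarrow> leaves T ! i \<noteq> []"
proof -
  assume "T \<noteq> Leaf" "i < length (leaves T)"
  moreover from this(1) have "[] \<notin> set (leaves T)" by (cases T) auto
  ultimately show ?thesis by (metis nth_mem)
qed

text \<open>Some leaf of \<open>Tp\<close> is comparable with \<open>u\<close>, and uniqueness of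
  image words makes the two pairs differ by a common suffix \<open>w\<close>. The parity of the
  summed lengths is therefore the same for the pair and the leaf.\<close>

lemma represents_maps_word_cases:
  assumes "represents Tp Tm f" "maps_word f u x"
  shows "\<exists>i<length (leaves Tp). \<exists>w.
     (u = leaves Tp ! i @ w \<and> x = leaves Tm ! i @ w) \<or>
     (leaves Tp ! i = u @ w \<and> leaves Tm ! i = x @ w)"
proof -
  obtain i where i: "i < length (leaves Tp)" "prefix u (leaves Tp ! i) \<or> prefix (leaves Tp ! i) u"
    using leaf_comparable by blast
  then have leaf: "maps_word f (leaves Tp ! i) (leaves Tm ! i)" using assms(1) represents_iff by blast
  from i(2) consider w where "leaves Tp ! i = u @ w" | w where "u = leaves Tp ! i @ w"
    by (auto simp: prefix_def)
  then show ?thesis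
  proof cases
    case 1
    then have "leaves Tm ! i = x @ w" using leaf assms(2) maps_word_cancel by metis
    then show ?thesis using 1 i by blast
  next
    case 2
    then have "x = leaves Tm ! i @ w" using leaf assms(2) maps_word_cancel by metis
    then show ?thesis using 2 i by blast
  qed
qed

text \<open>Ranging over all mapped words frees the condition from the choice of a tree diagram.
  Nonempty words are taken because appending adds lengths to \<open>planar_weight\<close> only when
  the first letter is already there.\<close>

definition planar_even :: "(real \<Rightarrow> real) \<Rightarrow> bool" where
  "planar_even f \<longleftrightarrow> (\<forall>u x. u \<noteq> [] \<longrightarrow> x \<noteq> [] \<longrightarrow> maps_word f u x \<longrightarrow>
     even (planar_weight u + planar_weight x))"

definition length_even :: "(real \<Rightarrow> real) \<Rightarrow> bool" where
  "length_even f \<longleftrightarrow> (\<forall>u x. maps_word f u x \<longrightarrow> even (length u + length x))"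

lemma planar_parity_leaf:
  assumes T: "represents Tp Tm f" "Tp \<noteq> Leaf" "Tm \<noteq> Leaf"
    and u: "u \<noteq> []" "x \<noteq> []" "maps_word f u x"
  shows "\<exists>i<length (leaves Tp). even (planar_weight u + planar_weight x) =
     even (planar_weight (leaves Tp ! i) + planar_weight (leaves Tm ! i))"
proof -
  obtain i w where i: "i < length (leaves Tp)"
    "(u = leaves Tp ! i @ w \<and> x = leaves Tm ! i @ w) \<or> (leaves Tp ! i = u @ w \<and> leaves Tm ! i = x @ w)"
    using represents_maps_word_cases[OF T(1) u(3)] by blast
  have "leaves Tp ! i \<noteq> []" "leaves Tm ! i \<noteq> []"
    using leaf_not_Nil T i(1) by (auto simp: represents_def tree_diagram_def)
  then have "even (planar_weight u + planar_weight x) =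
     even (planar_weight (leaves Tp ! i) + planar_weight (leaves Tm ! i))"
    using i(2) u by (auto simp: planar_weight_append)
  then show ?thesis using i(1) by blast
qed

text \<open>Colourability forces one parity on all branches, and \<open>K22\<close> settles it: at 0
  planar weights are word lengths, so an even slope exponent makes the common parity even. At 1 both
  weights exceed the lengths by one, which leaves the parity of the sum unchanged.\<close>

lemma E_EVEN_iff: "f \<in> E_EVEN \<longleftrightarrow> f \<in> F_carrier \<and> planar_even f"
proof (cases "f \<in> F_carrier")
  case f: True
  obtain N where N: "\<And>u. N \<le> length u \<Longrightarrow> \<exists>x. x \<noteq> [] \<and> maps_word f u x"
    using F_carrier_maps_word[OF f] by blast
  define u where "u = replicate (Suc N) False"
  define v where "v = replicate (Suc N) True"
  obtain x y where x: "x \<noteq> []" "maps_word f u x" and y: "y \<noteq> []" "maps_word f v y"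
    using N[of u] N[of v] by (auto simp: u_def v_def)
  have u: "u \<noteq> []" "word_left u = 0"
    unfolding u_def by (simp, rule word_left_replicate_False)
  have v: "v \<noteq> []" "word_left v + 1 / 2 ^ length v = 1"
    unfolding v_def word_left_replicate_True by simp_all
  have "word_left x = 0" "word_left y + 1 / 2 ^ length y = 1"
    using maps_word_left[OF x(2)] maps_word_right[OF y(2)] u v F_carrier_endpoints[OF f] by auto
  then have weights: "planar_weight u = length u" "planar_weight x = length x"
    "planar_weight v = Suc (length v)" "planar_weight y = Suc (length y)"
    using planar_weight_left planar_weight_right u v x y by auto
  note K22 = K22_iff[OF f x(2) u(2) y(2) v(2)]
  show ?thesis
  proof
    assume "f \<in> E_EVEN"
    then obtain Tp Tm where T: "represents Tp Tm f" "planar_3_colorable Tp Tm" and "f \<in> K22"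
      unfolding E_EVEN_def planar_3_colorable_subgroup_def by blast
    then have even0: "even (planar_weight u + planar_weight x)" using K22 weights by simp
    have leaf_iff: "Tm = Leaf \<longleftrightarrow> Tp = Leaf"
      using T(1) by (simp add: represents_def tree_diagram_def flip: length_leaves_eq_1)
    have "planar_even f"
    proof (cases "Tp = Leaf")
      \<comment> \<open>A pair of single leaves represents only the identity, under which every word
        is its own image.\<close>
      case True
      then have "maps_word f [] []" using T(1) leaf_iff by (auto simp: represents_iff)
      then have "maps_word f w w" for w using maps_word_append[of f "[]" "[]" w] by simp
      then have "w = z" if "maps_word f w z" for w z using that maps_word_unique by blast
      then show ?thesis by (auto simp: planar_even_def)
    next
      case False
      then have Tm: "Tm \<noteq> Leaf" using leaf_iff by blast
      obtain b where b: "\<And>i. i<length (leaves Tp) \<Longrightarrow>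
          even (planar_weight (leaves Tp ! i) + planar_weight (leaves Tm ! i)) = b"
        using T planar_3_colorable_iff[OF _ False Tm] represents_def by blast
      have "even (planar_weight w + planar_weight z) = b"
        if "w \<noteq> []" "z \<noteq> []" "maps_word f w z" for w z
        using planar_parity_leaf[OF T(1) False Tm that] b by metis
      then show ?thesis using even0 u x unfolding planar_even_def by metis
    qed
    then show "f \<in> F_carrier \<and> planar_even f" using f by blast
  next
    assume "f \<in> F_carrier \<and> planar_even f"
    then have even: "even (planar_weight w + planar_weight z)"
      if "w \<noteq> []" "z \<noteq> []" "maps_word f w z" for w z using that unfolding planar_even_def by blast
    obtain Tp Tm where T: "represents Tp Tm f" "Tp \<noteq> Leaf" "Tm \<noteq> Leaf"
      using F_carrier_tree_diagram[OF f] by blast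
    have td: "tree_diagram Tp Tm" using T(1) by (simp add: represents_def)
    have "even (planar_weight (leaves Tp ! i) + planar_weight (leaves Tm ! i))"
      if "i < length (leaves Tp)" for i
      using T td that leaf_not_Nil by (intro even) (auto simp: represents_iff tree_diagram_def)
    then have "planar_3_colorable Tp Tm" using planar_3_colorable_iff[OF td T(2,3)] by blast
    moreover have "f \<in> K22"
      unfolding K22 using even[OF u(1) x] even[OF v(1) y] weights by simp
    ultimately show "f \<in> E_EVEN"
      unfolding E_EVEN_def planar_3_colorable_subgroup_def using f T(1) by blast
  qed
qed (simp add: E_EVEN_def K22_def)

lemma three_colorable_subgroup_iff: "f \<in> three_colorable_subgroup \<longleftrightarrow> f \<in> F_carrier \<and> length_even f"
proof
  assume "f \<in> three_colorable_subgroup"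
  then obtain Tp Tm where f: "f \<in> F_carrier" and T: "represents Tp Tm f" "strip_3_colorable Tp Tm"
    unfolding three_colorable_subgroup_def by blast
  then have even: "even (length (leaves Tp ! i) + length (leaves Tm ! i))" if "i < length (leaves Tp)" for i
    using strip_3_colorable_iff that represents_def by blast
  have "even (length u + length x)" if ux: "maps_word f u x" for u x
  proof -
    obtain i w where "i < length (leaves Tp)"
      "(u = leaves Tp ! i @ w \<and> x = leaves Tm ! i @ w) \<or> (leaves Tp ! i = u @ w \<and> leaves Tm ! i = x @ w)"
      using represents_maps_word_cases[OF T(1) ux] by blast
    then show ?thesis using even[of i] by auto
  qed
  then show "f \<in> F_carrier \<and> length_even f" using f by (simp add: length_even_def)
next
  assume f: "f \<in> F_carrier \<and> length_even f"
  then obtain Tp Tm where T: "represents Tp Tm f" using F_carrier_tree_diagram by blast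
  then have "tree_diagram Tp Tm" by (simp add: represents_def)
  then have "strip_3_colorable Tp Tm"
    using T f by (auto simp: strip_3_colorable_iff represents_iff length_even_def)
  then show "f \<in> three_colorable_subgroup" using f T by (auto simp: three_colorable_subgroup_def)
qed

text \<open>\<open>f\<close> need not carry \<open>u\<close> to a word. Appending \<open>v\<close>
  and \<open>w\<close> makes both \<open>f\<close> and \<open>g\<close> act on words; the same
  suffix reappears in the final image, so the parity for \<open>u\<close> and \<open>x\<close> is
  not affected.\<close>

lemma planar_even_comp:
  assumes f: "f \<in> F_carrier" "planar_even f" and g: "g \<in> F_carrier" "planar_even g"
  shows "planar_even (\<lambda>t. g (f t))"
  unfolding planar_even_def
proof (intro allI impI)
  fix u x assume u: "u \<noteq> []" "x \<noteq> []" "maps_word (\<lambda>t. g (f t)) u x"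
  obtain N where N: "\<And>u. N \<le> length u \<Longrightarrow> \<exists>x. x \<noteq> [] \<and> maps_word f u x"
    using F_carrier_maps_word[OF f(1)] by blast
  obtain M where M: "\<And>u. M \<le> length u \<Longrightarrow> \<exists>x. x \<noteq> [] \<and> maps_word g u x"
    using F_carrier_maps_word[OF g(1)] by blast
  obtain v :: "bool list" where v: "length v = N" using ex_word[of 0 N] by auto
  obtain w :: "bool list" where w: "length w = M" using ex_word[of 0 M] by auto
  obtain y where y: "y \<noteq> []" "maps_word f (u @ v) y" using N[of "u @ v"] v by auto
  obtain z where z: "z \<noteq> []" "maps_word g (y @ w) z" using M[of "y @ w"] w by auto
  have fw: "maps_word f (u @ v @ w) (y @ w)" using maps_word_append[OF y(2), of w] by simp
  then have "z = x @ v @ w" using maps_word_comp[OF fw z(2)] u(3) maps_word_cancel by blast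
  moreover have "even (planar_weight (u @ v @ w) + planar_weight (y @ w))"
    using f(2) fw u(1) y(1) unfolding planar_even_def by blast
  moreover have "even (planar_weight (y @ w) + planar_weight z)"
    using g(2) z y(1) unfolding planar_even_def by blast
  ultimately show "even (planar_weight u + planar_weight x)"
    using u(1,2) y(1) by (auto simp: planar_weight_append)
qed

lemma subgroup_E_EVEN: "subgroup E_EVEN thompson_F"
proof -
  interpret group thompson_F by (rule group_thompson_F)
  show ?thesis
  proof (rule subgroupI)
    show "E_EVEN \<subseteq> F_carrier" by (auto simp: E_EVEN_iff)
    have "planar_even (\<lambda>t. t)"
      using maps_word_unique[OF maps_word_ident] by (auto simp: planar_even_def)
    then show "E_EVEN \<noteq> {}" using F_carrier_ident E_EVEN_iff by blast
  next
    fix f assume "f \<in> E_EVEN"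
    then have f: "f \<in> F_carrier" "planar_even f" by (auto simp: E_EVEN_iff)
    have "maps_word f x u" if "maps_word (inv\<^bsub>thompson_F\<^esub> f) u x" for u x
      by (rule maps_word_inverse[OF that]) (rule F_inv_apply[OF f(1)])
    then have "planar_even (inv\<^bsub>thompson_F\<^esub> f)"
      using f(2) unfolding planar_even_def by (metis add.commute)
    then show "inv\<^bsub>thompson_F\<^esub> f \<in> E_EVEN" using f by (simp add: E_EVEN_iff)
  next
    fix f g assume "f \<in> E_EVEN" "g \<in> E_EVEN"
    then show "f \<otimes>\<^bsub>thompson_F\<^esub> g \<in> E_EVEN"
      by (simp add: E_EVEN_iff F_carrier_comp planar_even_comp)
  qed
qed

subsection \<open>Generators\<close>

lemma phi_R_apply: "s \<in> {0..1} \<Longrightarrow> phi_R g (1/2 + s/2) = 1/2 + g s / 2"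
  by (simp add: phi_R_def)

lemma phi_R_left: "g 0 = 0 \<Longrightarrow> t \<le> 1/2 \<Longrightarrow> phi_R g t = t"
proof (cases "t = 1/2")
  case True
  show "g 0 = 0 \<Longrightarrow> ?thesis" unfolding True by (simp add: phi_R_def)
qed (auto simp: phi_R_def)

lemma maps_word_phi_R_True:
  "maps_word (phi_R g) (True # u) (True # x) \<longleftrightarrow> maps_word g u x"
proof -
  have "phi_R g (word_left (True # u) + r / 2 ^ length (True # u)) =
          word_left (True # x) + r / 2 ^ length (True # x) \<longleftrightarrow>
        g (word_left u + r / 2 ^ length u) = word_left x + r / 2 ^ length x" if r: "r \<in> {0..1}" for r
  proof -
    have "word_left (True # u) + r / 2 ^ length (True # u) = 1/2 + (word_left u + r / 2 ^ length u) / 2"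
      by (simp add: field_simps)
    then have "phi_R g (word_left (True # u) + r / 2 ^ length (True # u)) =
        1/2 + g (word_left u + r / 2 ^ length u) / 2"
      by (simp only: phi_R_apply[OF word_interval_subset[OF r]])
    then show ?thesis by (auto simp: add_divide_distrib)
  qed
  then show ?thesis unfolding maps_word_def by blast
qed

lemma maps_word_phi_R_False:
  assumes "g 0 = 0" shows "maps_word (phi_R g) (False # u) (False # u)"
  unfolding maps_word_def
proof
  fix r :: real assume "r \<in> {0..1}"
  then have "word_left u + r / 2 ^ length u \<le> 1" using word_interval_subset by auto
  then have "word_left (False # u) + r / 2 ^ length (False # u) \<le> 1/2" by (simp add: field_simps)
  then show "phi_R g (word_left (False # u) + r / 2 ^ length (False # u)) =
      word_left (False # u) + r / 2 ^ length (False # u)"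
    using phi_R_left[of g] assms by blast
qed

lemma word_left_ge_half: "1/2 \<le> word_left u \<Longrightarrow> \<exists>v. u = True # v"
proof (cases u)
  case (Cons b v)
  then show "1/2 \<le> word_left u \<Longrightarrow> ?thesis" using word_left_less_1[of v] by (cases b) auto
qed auto

lemma phi_R_in_F_carrier:
  assumes g: "g \<in> F_carrier" shows "phi_R g \<in> F_carrier"
proof -
  have cont: "continuous_on {0..1} (phi_R g)" if g: "g \<in> F_carrier" for g
  proof -
    have g01: "continuous_on {0..1} g" using g unfolding F_carrier_iff homeomorphism_def by blast
    have "continuous_on {0..1} (\<lambda>t. if t \<le> 1/2 then t else 1/2 + 1/2 * g (2 * t - 1))"
    proof (rule continuous_on_cases_le)
      show "continuous_on {t \<in> {0..1}. 1/2 \<le> t} (\<lambda>t. 1/2 + 1/2 * g (2 * t - 1))"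
        by (intro continuous_intros continuous_on_compose2[OF g01]) auto
      show "t = 1/2 + 1/2 * g (2 * t - 1)" if "t = 1/2" for t
        unfolding that by (simp add: F_carrier_endpoints[OF g])
    qed (intro continuous_intros)+
    then show ?thesis
      by (rule continuous_on_eq) (auto simp: phi_R_left F_carrier_endpoints[OF g], auto simp: phi_R_def)
  qed
  have range: "phi_R g t \<in> {0..1}" if g: "g \<in> F_carrier" and "t \<in> {0..1}" for g t
    using F_carrier_range[OF g, of "2 * t - 1"] that by (auto simp: phi_R_def)
  have inverse: "phi_R h (phi_R g t) = t" if "g \<in> F_carrier" "h \<in> F_carrier" "\<And>t. h (g t) = t" for g h t
  proof (cases "t \<in> {1/2..1}")
    case True
    then have "g (2 * t - 1) \<in> {0..1}" using F_carrier_range[OF that(1)] by simp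
    then show ?thesis using True phi_R_apply[of "g (2 * t - 1)" h] that(3)
      by (simp add: phi_R_def[of g] field_simps)
  next
    case False
    then have "phi_R f t = t" for f by (simp only: phi_R_def if_False)
    then show ?thesis by simp
  qed
  obtain h where h: "h \<in> F_carrier" "\<And>t. h (g t) = t" "\<And>t. g (h t) = t"
    using F_carrier_inverse[OF g] by blast
  have hom: "homeomorphism {0..1} {0..1} (phi_R g) (phi_R h)"
  proof (rule homeomorphismI)
    show "phi_R g ` {0..1} \<subseteq> {0..1}" "phi_R h ` {0..1} \<subseteq> {0..1}"
      by (intro image_subsetI range g h; assumption)+
  qed (rule cont inverse g h)+
  obtain N where N: "\<And>u. N \<le> length u \<Longrightarrow> \<exists>x. x \<noteq> [] \<and> maps_word g u x"
    using F_carrier_maps_word[OF g] by blast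
  have "\<exists>x. maps_word (phi_R g) u x" if u: "length u = Suc N" for u
  proof -
    obtain b v where b: "u = b # v" "length v = N" using u by (cases u) auto
    show ?thesis
    proof (cases b)
      case True
      obtain x where "maps_word g v x" using N[of v] b by auto
      then have "maps_word (phi_R g) u (True # x)" using b True by (simp add: maps_word_phi_R_True)
      then show ?thesis ..
    next
      case False
      then have "maps_word (phi_R g) u u"
        using b maps_word_phi_R_False[of g v] F_carrier_endpoints(1)[OF g] by simp
      then show ?thesis ..
    qed
  qed
  then show ?thesis
    by (intro F_carrierI[OF hom, of "Suc N"]) (auto simp: phi_R_def)
qed

text \<open>\<open>G\<close> rescales the right half to the unit interval and so undoes
  \<open>phi_R\<close>. The inverse \<open>k\<close> of \<open>h\<close> fixes the left half too,
  and \<open>G k\<close> is the inverse of \<open>G h\<close>.\<close>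

lemma ex_phi_R:
  assumes h: "h \<in> F_carrier" "\<And>t. t \<in> {0..1/2} \<Longrightarrow> h t = t"
  shows "\<exists>g\<in>F_carrier. phi_R g = h"
proof -
  define G :: "(real \<Rightarrow> real) \<Rightarrow> real \<Rightarrow> real" where
    "G = (\<lambda>h t. if t \<in> {0..1} then 2 * h ((1 + t) / 2) - 1 else t)"
  obtain k where k: "k \<in> F_carrier" "\<And>t. k (h t) = t" "\<And>t. h (k t) = t"
    using F_carrier_inverse[OF h(1)] by blast
  have k2: "k t = t" if "t \<in> {0..1/2}" for t using k(2)[of t] h(2)[OF that] by simp
  have cont: "continuous_on {0..1} (G h)" if h: "h \<in> F_carrier" for h
  proof -
    have h01: "continuous_on {0..1} h" using h unfolding F_carrier_iff homeomorphism_def by blast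
    have "continuous_on {0..1} (\<lambda>t. 2 * h ((1 + t) / 2) - 1)"
      by (intro continuous_intros continuous_on_compose2[OF h01]) auto
    then show ?thesis by (rule continuous_on_eq) (simp add: G_def)
  qed
  have upper: "h t \<in> {1/2..1}"
    if h: "h \<in> F_carrier" "\<And>t. t \<in> {0..1/2} \<Longrightarrow> h t = t" and t: "t \<in> {1/2..1}" for h t
  proof -
    have "h (1/2) \<le> h t"
      using strict_mono_onD[OF F_carrier_endpoints(3)[OF h(1)], of "1/2" t] t
      by (cases "t = 1/2") (simp only: order.refl, auto)
    then show ?thesis using F_carrier_range[OF h(1), of t] h(2)[of "1/2"] t by auto
  qed
  have range: "G h t \<in> {0..1}"
    if "h \<in> F_carrier" "\<And>t. t \<in> {0..1/2} \<Longrightarrow> h t = t" and "t \<in> {0..1}" for h t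
    using upper[OF that(1,2), of "(1 + t) / 2"] that(3) by (auto simp: G_def)
  have inverse: "G k (G h t) = t"
    if "h \<in> F_carrier" "\<And>t. t \<in> {0..1/2} \<Longrightarrow> h t = t" "\<And>t. k (h t) = t" "t \<in> {0..1}" for h k t
    using range[OF that(1,2,4)] that(3,4) by (simp add: G_def add_divide_distrib)
  have hom: "homeomorphism {0..1} {0..1} (G h) (G k)"
  proof (rule homeomorphismI)
    show "G h ` {0..1} \<subseteq> {0..1}" "G k ` {0..1} \<subseteq> {0..1}"
      by (intro image_subsetI range[OF h] range[OF k(1) k2]; assumption)+
    show "G k (G h t) = t" if "t \<in> {0..1}" for t by (rule inverse[OF h k(2) that])
    show "G h (G k t) = t" if "t \<in> {0..1}" for t by (rule inverse[OF k(1) k2 k(3) that])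
  qed (intro cont h k)+
  have phi: "phi_R (G h) = h"
  proof
    fix t show "phi_R (G h) t = h t"
      using h(2)[of t] F_carrier_outside[OF h(1), of t] by (cases "t \<in> {0..1}") (auto simp: phi_R_def G_def diff_divide_distrib)
  qed
  obtain N where N: "\<And>u. N \<le> length u \<Longrightarrow> \<exists>x. x \<noteq> [] \<and> maps_word h u x"
    using F_carrier_maps_word[OF h(1)] by blast
  have "\<exists>x. maps_word (G h) u x" if u: "length u = N" for u
  proof -
    obtain x where x: "maps_word h (True # u) x" using N[of "True # u"] u by auto
    have half: "word_left (True # u) \<in> {1/2..1}"
      using word_left_bounds(1)[of u] word_left_less_1[of u] by simp
    \<comment> \<open>As \<open>h\<close> preserves the right half, the image word begins with
      \<open>True\<close>, and the first letters can be removed on both sides.\<close>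
    have "h (word_left (True # u)) \<in> {1/2..1}" by (rule upper[OF h(1) _ half]) (rule h(2))
    then have "1/2 \<le> word_left x" unfolding maps_word_left[OF x] by simp
    then obtain y where "x = True # y" using word_left_ge_half by blast
    then have "maps_word (phi_R (G h)) (True # u) (True # y)" using x phi by simp
    then show ?thesis unfolding maps_word_phi_R_True by blast
  qed
  then have "G h \<in> F_carrier" by (intro F_carrierI[OF hom, of N]) (auto simp: G_def)
  then show ?thesis using phi by blast
qed

text \<open>\<open>planar_weight (True # u)\<close> is \<open>length u + 2\<close>, so on the right
  half planar parity is length parity. Words beginning with \<open>False\<close> are mapped to
  themselves.\<close>

lemma phi_R_in_E_EVEN_iff:
  assumes g: "g \<in> F_carrier"
  shows "phi_R g \<in> E_EVEN \<longleftrightarrow> g \<in> three_colorable_subgroup"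
proof -
  note g0 = F_carrier_endpoints(1)[OF g]
  have "planar_even (phi_R g) \<longleftrightarrow> length_even g"
  proof
    assume *: "planar_even (phi_R g)"
    have "even (length u + length x)" if "maps_word g u x" for u x
    proof -
      have "maps_word (phi_R g) (True # u) (True # x)" using that by (simp only: maps_word_phi_R_True)
      then have "even (planar_weight (True # u) + planar_weight (True # x))"
        using * unfolding planar_even_def by blast
      then show ?thesis by simp
    qed
    then show "length_even g" by (simp add: length_even_def)
  next
    assume *: "length_even g"
    show "planar_even (phi_R g)"
      unfolding planar_even_def
    proof (intro allI impI)
      fix u x assume u: "u \<noteq> []" "x \<noteq> []" "maps_word (phi_R g) u x"
      then obtain b v where b: "u = b # v" by (cases u) auto
      show "even (planar_weight u + planar_weight x)"
      proof (cases b)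
        case True
        have "1/2 \<le> phi_R g (word_left u)"
          using F_carrier_range[OF g, of "word_left v"] word_left_bounds(1)[of v] word_left_less_1[of v]
            phi_R_apply[of "word_left v" g] b True by auto
        then obtain y where y: "x = True # y" using maps_word_left[OF u(3)] word_left_ge_half by auto
        then have "maps_word g v y" using u(3) b True by (simp add: maps_word_phi_R_True)
        then have "even (length v + length y)" using * by (simp add: length_even_def)
        then show ?thesis using b True y by simp
      next
        case False
        then have "maps_word (phi_R g) u u" using b maps_word_phi_R_False[of g v] g0 by simp
        then have "x = u" using u(3) maps_word_unique by blast
        then show ?thesis by simp
      qed
    qed
  qed
  then show ?thesis using g phi_R_in_F_carrier by (simp add: E_EVEN_iff three_colorable_subgroup_iff)
qed

section \<open>The element \<open>x0\<close> and its square\<close>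

lemma maps_word_x0:
  "maps_word x0 [False, False] [False]" "maps_word x0 [False, True] [True, False]"
  "maps_word x0 [True] [True, True]"
  unfolding maps_word_iff_binary_value using x0_binary by blast+

lemma x0_in_F_carrier: "x0 \<in> F_carrier"
proof -
  \<comment> \<open>The inverse of \<open>x0\<close>. On the unit interval \<open>x0\<close> is
    concave and its inverse convex, so they are the minimum and the maximum of their affine pieces,
    which makes continuity immediate.\<close>
  define y :: "real \<Rightarrow> real" where
    "y t = max (t / 2) (max (t - 1/4) (2 * t - 1))" for t
  have eq: "x0 t = min (2 * t) (min (t + 1/4) (t / 2 + 1/2))" if "t \<in> {0..1}" for t
    using that by (auto simp: x0_def min_def)
  have "continuous_on {0..1} (\<lambda>t::real. min (2 * t) (min (t + 1/4) (t / 2 + 1/2)))"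
    by (intro continuous_intros) auto
  then have "continuous_on {0..1} x0" by (rule continuous_on_eq) (simp add: eq)
  moreover have "continuous_on {0..1} y" unfolding y_def by (intro continuous_intros) auto
  moreover have "x0 ` {0..1} \<subseteq> {0..1}" by (auto simp: eq)
  moreover have "y ` {0..1} \<subseteq> {0..1}" by (auto simp: y_def le_max_iff_disj)
  moreover have "y (x0 t) = t" if "t \<in> {0..1}" for t
  proof -
    consider "t \<le> 1/4" | "1/4 \<le> t" "t \<le> 1/2" | "1/2 \<le> t" by linarith
    then show ?thesis using that by cases (simp_all add: eq y_def min_def max_def)
  qed
  moreover have "x0 (y t) = t" if "t \<in> {0..1}" for t
  proof -
    consider "y t = t / 2" "t \<le> 1/2" | "y t = t - 1/4" "1/2 \<le> t" "t \<le> 3/4" | "y t = 2 * t - 1" "3/4 \<le> t"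
      by (cases "t \<le> 1/2"; cases "t \<le> 3/4") (simp_all add: y_def max_def)
    then show ?thesis using that by cases (auto simp: eq min_def field_simps)
  qed
  ultimately have hom: "homeomorphism {0..1} {0..1} x0 y" by (rule homeomorphismI)
  have "\<exists>x. maps_word x0 u x" if u: "length u = 2" for u
  proof -
    obtain a b where "u = [a, b]" using u by (cases u; cases "tl u") auto
    then show ?thesis
      using maps_word_x0(1,2) maps_word_append[OF maps_word_x0(3), of "[b]"] by (cases a; cases b) auto
  qed
  then show ?thesis by (intro F_carrierI[OF hom, of 2]) (auto simp: x0_def)
qed

definition x0_squared :: "real \<Rightarrow> real" where
  "x0_squared = x0 [^]\<^bsub>thompson_F\<^esub> (2::nat)"

lemma x0_squared_eq: "x0_squared = (\<lambda>t. x0 (x0 t))"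
  by (simp add: x0_squared_def nat_pow_def numeral_2_eq_2)

lemma x0_squared_in_F_carrier: "x0_squared \<in> F_carrier"
  unfolding x0_squared_eq using x0_in_F_carrier F_carrier_comp by blast

lemma maps_word_x0_squared:
  "maps_word x0_squared [False, False, False] [False]"
  "maps_word x0_squared [False, False, True] [True, False]"
  "maps_word x0_squared [False, True] [True, True, False]"
  "maps_word x0_squared [True] [True, True, True]"
  unfolding x0_squared_eq
  using maps_word_comp[OF maps_word_append[OF maps_word_x0(1), of "[False]"], of x0]
    maps_word_comp[OF maps_word_append[OF maps_word_x0(1), of "[True]"], of x0]
    maps_word_comp[OF maps_word_x0(2), of x0] maps_word_comp[OF maps_word_x0(3), of x0]
    maps_word_x0 maps_word_append[OF maps_word_x0(3), of "[False]"]
    maps_word_append[OF maps_word_x0(3), of "[True]"]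
  by auto

text \<open>The trees are the left and the right comb with four leaves. From left to right the
  planar weights are 3, 3, 2, 2 in \<open>Tp\<close> and 1, 3, 4, 4 in \<open>Tm\<close>, so all
  sums are even.\<close>

lemma x0_squared_in_E_EVEN: "x0_squared \<in> E_EVEN"
proof -
  define Tp where "Tp = Node (Node (Node Leaf Leaf) Leaf) Leaf"
  define Tm where "Tm = Node Leaf (Node Leaf (Node Leaf Leaf))"
  have Tp: "leaves Tp = [[False, False, False], [False, False, True], [False, True], [True]]"
    and Tm: "leaves Tm = [[False], [True, False], [True, True, False], [True, True, True]]"
    by (simp_all add: Tp_def Tm_def)
  have "represents Tp Tm x0_squared"
    using maps_word_x0_squared by (auto simp: represents_iff tree_diagram_def Tp Tm less_Suc_eq)
  then have "planar_even x0_squared"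
    using planar_parity_leaf[of Tp Tm x0_squared]
    by (fastforce simp: planar_even_def Tp Tm less_Suc_eq Tp_def Tm_def)
  then show ?thesis using x0_squared_in_F_carrier by (simp add: E_EVEN_iff)
qed

text \<open>Each factor removes two letters, so every all-\<open>False\<close> word of odd length is
  carried onto the left half by a power of \<open>x0_squared\<close>.\<close>

lemma maps_word_x0_squared_pow:
  "maps_word (x0_squared [^]\<^bsub>thompson_F\<^esub> (k::nat)) (replicate (2 * k + 1) False) [False]"
proof -
  interpret group thompson_F by (rule group_thompson_F)
  show ?thesis
  proof (induction k)
    case 0
    show ?case by (simp add: maps_word_ident)
  next
    case (Suc k)
    have "replicate (2 * Suc k + 1) False = replicate (2 * k + 1) False @ replicate 2 False"
      unfolding replicate_add[symmetric] by simp
    also have "replicate 2 False = [False, False]" by (simp add: numeral_2_eq_2)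
    finally have "replicate (2 * Suc k + 1) False = replicate (2 * k + 1) False @ [False, False]" .
    then have "maps_word (x0_squared [^]\<^bsub>thompson_F\<^esub> k) (replicate (2 * Suc k + 1) False) [False, False, False]"
      using maps_word_append[OF Suc.IH, of "[False, False]"] by simp
    from maps_word_comp[OF this maps_word_x0_squared(1)] show ?case by simp
  qed
qed

section \<open>Decomposition of elements of \<open>E_EVEN\<close>\<close>

lemma maps_word_inv:
  assumes "f \<in> F_carrier" "maps_word f u x" shows "maps_word (inv\<^bsub>thompson_F\<^esub> f) x u"
  using assms(2) by (rule maps_word_inverse) (rule F_inv_apply[OF assms(1)])

lemma (in group) subgroup_nat_pow_closed:
  "subgroup H G \<Longrightarrow> a \<in> H \<Longrightarrow> a [^] (n::nat) \<in> H"
  by (induction n) (auto simp: subgroup.one_closed subgroup.m_closed)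

lemma E_EVEN_identity_left_half:
  assumes "f \<in> E_EVEN" "maps_word f [False] [False]"
  shows "f \<in> phi_R ` three_colorable_subgroup"
proof -
  have f: "f \<in> F_carrier" using assms(1) E_EVEN_iff by blast
  have "f t = t" if "t \<in> {0..1/2}" for t
    using maps_word_affine[OF assms(2), of t] that by simp
  then obtain g where "g \<in> F_carrier" "phi_R g = f" using ex_phi_R[OF f] by blast
  then show ?thesis using phi_R_in_E_EVEN_iff[of g] assms(1) by blast
qed

text \<open>An element of \<open>E_EVEN\<close> has slope an even power of 2 at 0, so it can be matched there by
  powers of \<open>x0\<^sup>2\<close>, whose slope at 0 is 4: multiplying by such powers on both sides makes it trivial on
  the left half of the unit interval.\<close>
lemma E_EVEN_decompose:
  assumes "f \<in> E_EVEN"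
  shows "\<exists>(p::nat) (q::nat). \<exists>z \<in> phi_R ` three_colorable_subgroup.
    f = (x0_squared [^]\<^bsub>thompson_F\<^esub> p) \<otimes>\<^bsub>thompson_F\<^esub> z
          \<otimes>\<^bsub>thompson_F\<^esub> inv\<^bsub>thompson_F\<^esub> (x0_squared [^]\<^bsub>thompson_F\<^esub> q)"
proof -
  interpret group thompson_F by (rule group_thompson_F)
  have f: "f \<in> F_carrier" "planar_even f" using assms E_EVEN_iff by auto
  obtain N where N: "\<And>u. N \<le> length u \<Longrightarrow> \<exists>x. x \<noteq> [] \<and> maps_word f u x"
    using F_carrier_maps_word[OF f(1)] by blast
  \<comment> \<open>Long enough for \<open>f\<close> to act on it, and of odd length, as
    \<open>maps_word_x0_squared_pow\<close> demands.\<close>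
  define u where "u = replicate (2 * N + 1) False"
  have u: "word_left u = 0" unfolding u_def by (rule word_left_replicate_False)
  obtain x where x: "x \<noteq> []" "maps_word f u x" using N[of u] by (auto simp: u_def)
  have x0: "word_left x = 0" using maps_word_left[OF x(2)] u F_carrier_endpoints(1)[OF f(1)] by simp
  have "u \<noteq> []" by (simp add: u_def)
  then have "even (planar_weight u + planar_weight x)"
    using f(2) x unfolding planar_even_def by blast
  \<comment> \<open>Both words consist of \<open>False\<close> only, so their planar weights are
    their lengths; as \<open>length u\<close> is odd, so is \<open>length x\<close>.\<close>
  then have "odd (length x)" using planar_weight_left u x0 by (simp add: u_def)
  then obtain q where q: "length x = 2 * q + 1" by (rule oddE)
  then have x_eq: "x = replicate (2 * q + 1) False" using word_left_eq_0[OF x0] by simp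
  define a where "a = x0_squared [^]\<^bsub>thompson_F\<^esub> N"
  define b where "b = x0_squared [^]\<^bsub>thompson_F\<^esub> q"
  interpret E: subgroup E_EVEN thompson_F by (rule subgroup_E_EVEN)
  have ab: "a \<in> E_EVEN" "b \<in> E_EVEN"
    unfolding a_def b_def using x0_squared_in_E_EVEN subgroup_E_EVEN by (metis subgroup_nat_pow_closed)+
  then have ab': "a \<in> F_carrier" "b \<in> F_carrier" using E.subset by auto
  define z where "z = inv\<^bsub>thompson_F\<^esub> a \<otimes>\<^bsub>thompson_F\<^esub> f \<otimes>\<^bsub>thompson_F\<^esub> b"
  have "z \<in> E_EVEN" unfolding z_def using ab assms by (intro E.m_closed E.m_inv_closed)
  \<comment> \<open>The inverse of \<open>a\<close>, then \<open>f\<close>, then \<open>b\<close>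
    lead from \<open>[False]\<close> to \<open>u\<close> to \<open>x\<close> and back to
    \<open>[False]\<close>, so \<open>z\<close> is the identity on the left half.\<close>
  have "maps_word (inv\<^bsub>thompson_F\<^esub> a) [False] u"
    unfolding a_def u_def using ab'(1) maps_word_x0_squared_pow by (intro maps_word_inv) (simp_all add: a_def)
  from maps_word_comp[OF maps_word_comp[OF this x(2)], of b "[False]"]
  have "maps_word z [False] [False]"
    using maps_word_x0_squared_pow[of q] unfolding z_def b_def x_eq by simp
  then have "z \<in> phi_R ` three_colorable_subgroup"
    using \<open>z \<in> E_EVEN\<close> E_EVEN_identity_left_half by blast
  moreover have "f = a \<otimes>\<^bsub>thompson_F\<^esub> z \<otimes>\<^bsub>thompson_F\<^esub> inv\<^bsub>thompson_F\<^esub> b"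
    using F_inv_apply[OF ab'(1)] F_inv_apply[OF ab'(2)] by (simp add: z_def)
  ultimately show ?thesis
    unfolding a_def b_def by (intro exI[of _ N] exI[of _ q] bexI[of _ z])
qed

lemma phi_R_image_subset: "phi_R ` three_colorable_subgroup \<subseteq> E_EVEN"
  using phi_R_in_E_EVEN_iff three_colorable_subgroup_iff by blast

lemma E_EVEN_generated_R:
  "E_EVEN = generate thompson_F (insert x0_squared (phi_R ` three_colorable_subgroup))"
    (is "_ = generate _ ?S")
proof
  interpret group thompson_F by (rule group_thompson_F)
  have S: "?S \<subseteq> E_EVEN" using phi_R_image_subset x0_squared_in_E_EVEN by blast
  then show "generate thompson_F ?S \<subseteq> E_EVEN" using generate_subgroup_incl subgroup_E_EVEN by blast
  interpret H: subgroup "generate thompson_F ?S" thompson_F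
    by (rule generate_is_subgroup) (use S E_EVEN_iff in blast)
  have gen: "s \<in> generate thompson_F ?S" if "s \<in> ?S" for s using that by (rule generate.incl)
  have pow: "x0_squared [^]\<^bsub>thompson_F\<^esub> (k::nat) \<in> generate thompson_F ?S" for k
    using gen[of x0_squared] H.subgroup_axioms by (intro subgroup_nat_pow_closed) auto
  show "E_EVEN \<subseteq> generate thompson_F ?S"
  proof
    fix f assume "f \<in> E_EVEN"
    then obtain p q :: nat and z where z: "z \<in> phi_R ` three_colorable_subgroup"
      and f: "f = (x0_squared [^]\<^bsub>thompson_F\<^esub> p) \<otimes>\<^bsub>thompson_F\<^esub> z
          \<otimes>\<^bsub>thompson_F\<^esub> inv\<^bsub>thompson_F\<^esub> (x0_squared [^]\<^bsub>thompson_F\<^esub> q)"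
      using E_EVEN_decompose by blast
    show "f \<in> generate thompson_F ?S"
      unfolding f using z by (intro H.m_closed H.m_inv_closed pow gen insertI2)
  qed
qed

section \<open>The reflection exchanging left and right\<close>

definition flip :: "(real \<Rightarrow> real) \<Rightarrow> real \<Rightarrow> real" where
  "flip f t = 1 - f (1 - t)"

lemma flip_flip [simp]: "flip (flip f) = f"
  by (simp add: flip_def fun_eq_iff)

lemma word_left_map_Not: "word_left (map Not u) = 1 - (word_left u + 1 / 2 ^ length u)"
  by (induction u) (auto simp: field_simps)

lemma maps_word_flip:
  assumes "maps_word f u x" shows "maps_word (flip f) (map Not u) (map Not x)"
  unfolding maps_word_def
proof
  fix r :: real assume "r \<in> {0..1}"
  then have "f (word_left u + (1 - r) / 2 ^ length u) = word_left x + (1 - r) / 2 ^ length x"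
    using assms unfolding maps_word_def by simp
  then show "flip f (word_left (map Not u) + r / 2 ^ length (map Not u)) =
      word_left (map Not x) + r / 2 ^ length (map Not x)"
    by (simp add: flip_def word_left_map_Not diff_divide_distrib add.commute diff_add_eq add_diff_eq)
qed

lemma map_Not_Not [simp]: "map Not (map Not u) = u"
  by (simp add: comp_def)

lemma flip_in_F_carrier:
  assumes f: "f \<in> F_carrier" shows "flip f \<in> F_carrier"
proof -
  obtain g where g: "homeomorphism {0..1} {0..1} f g" using f F_carrier_iff by blast
  have "homeomorphism {0..1} {0..1} (\<lambda>t::real. 1 - t) (\<lambda>t. 1 - t)"
    by (rule homeomorphismI) (auto intro!: continuous_intros)
  from homeomorphism_compose[OF homeomorphism_compose[OF this g] this]
  have hom: "homeomorphism {0..1} {0..1} (flip f) (flip g)"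
    by (simp add: flip_def[abs_def] comp_def)
  obtain N where N: "\<And>u. N \<le> length u \<Longrightarrow> \<exists>x. x \<noteq> [] \<and> maps_word f u x"
    using F_carrier_maps_word[OF f] by blast
  have "\<exists>x. maps_word (flip f) u x" if u: "length u = N" for u
  proof -
    obtain x where "maps_word f (map Not u) x" using N[of "map Not u"] u by auto
    from maps_word_flip[OF this] show ?thesis unfolding map_Not_Not ..
  qed
  then show ?thesis
    by (intro F_carrierI[OF hom, of N]) (auto simp: flip_def F_carrier_outside[OF f])
qed

lemma flip_in_three_colorable_subgroup:
  assumes "f \<in> three_colorable_subgroup" shows "flip f \<in> three_colorable_subgroup"
proof -
  have "even (length u + length x)" if "maps_word (flip f) u x" for u x
  proof -
    have "maps_word f (map Not u) (map Not x)" using maps_word_flip[OF that] by simp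
    then have "even (length (map Not u) + length (map Not x))"
      using assms unfolding three_colorable_subgroup_iff length_even_def by blast
    then show ?thesis by simp
  qed
  then show ?thesis
    using assms flip_in_F_carrier by (auto simp: three_colorable_subgroup_iff length_even_def)
qed

text \<open>Changing the first letter changes the correction by one. In a pair of words the two
  changes cancel, so \<open>E_EVEN\<close> is invariant under \<open>flip\<close>.\<close>

lemma even_planar_weight_map_Not:
  "u \<noteq> [] \<Longrightarrow> even (planar_weight (map Not u)) \<longleftrightarrow> odd (planar_weight u)"
  by (cases u) auto

lemma flip_in_E_EVEN:
  assumes "f \<in> E_EVEN" shows "flip f \<in> E_EVEN"
proof -
  have "even (planar_weight u + planar_weight x)"
    if "maps_word (flip f) u x" "u \<noteq> []" "x \<noteq> []" for u x
  proof -
    have "maps_word f (map Not u) (map Not x)" using maps_word_flip[OF that(1)] by simp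
    then have "even (planar_weight (map Not u) + planar_weight (map Not x))"
      using assms that(2,3) unfolding E_EVEN_iff planar_even_def by blast
    then show ?thesis using that(2,3) by (simp add: even_planar_weight_map_Not)
  qed
  then show ?thesis
    using assms flip_in_F_carrier by (auto simp: E_EVEN_iff planar_even_def)
qed

lemma flip_phi_R: "flip (phi_R g) = phi_L (flip g)"
proof
  fix t :: real
  have "2 * (1 - t) - 1 = 1 - 2 * t" by simp
  moreover have "1 - t \<in> {1/2..1} \<longleftrightarrow> t \<in> {0..1/2}" by auto
  ultimately show "flip (phi_R g) t = phi_L (flip g) t"
    unfolding flip_def phi_R_def phi_L_def by (simp add: field_simps del: atLeastAtMost_iff)
qed

lemma flip_x0_x0: "flip x0 (x0 t) = t"
proof -
  consider "t < 0" | "0 \<le> t" "t \<le> 1/4" | "1/4 < t" "t \<le> 1/2" | "1/2 < t" "t \<le> 1" | "1 < t" by linarith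
  then show ?thesis by cases (auto simp: flip_def x0_def field_simps)
qed

lemma image_flip: "(\<And>f. f \<in> A \<Longrightarrow> flip f \<in> A) \<Longrightarrow> flip ` A = A"
  by (metis (no_types, lifting) flip_flip image_eqI subsetI subset_antisym image_subsetI)

lemma group_hom_flip: "group_hom thompson_F thompson_F flip"
proof -
  have "flip \<in> hom thompson_F thompson_F"
    by (auto simp: hom_def flip_in_F_carrier) (auto simp: flip_def fun_eq_iff)
  then show ?thesis
    using group_thompson_F by (simp add: group_hom_def group_hom_axioms_def)
qed

lemma flip_x0_squared: "flip x0_squared = inv\<^bsub>thompson_F\<^esub> x0_squared"
proof -
  interpret group thompson_F by (rule group_thompson_F)
  have "flip x0_squared (x0_squared t) = t" for t
  proof -
    have "flip x0_squared s = flip x0 (flip x0 s)" for s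
      by (simp add: x0_squared_eq flip_def)
    then show ?thesis by (simp add: x0_squared_eq flip_x0_x0)
  qed
  then have "x0_squared \<otimes>\<^bsub>thompson_F\<^esub> flip x0_squared = \<one>\<^bsub>thompson_F\<^esub>" by simp
  then show ?thesis
    using x0_squared_in_F_carrier flip_in_F_carrier by (metis inv_equality inv_inv inv_closed)
qed

text \<open>One inclusion is proved for an arbitrary \<open>a\<close> and then applied to
  \<open>inv a\<close> as well.\<close>

lemma (in group) generate_insert_inv:
  assumes "a \<in> carrier G" "S \<subseteq> carrier G"
  shows "generate G (insert (inv a) S) = generate G (insert a S)"
proof -
  have *: "generate G (insert (inv a) S) \<subseteq> generate G (insert a S)"
    if a: "a \<in> carrier G" for a
  proof (rule generate_subgroup_incl)
    show "insert (inv a) S \<subseteq> generate G (insert a S)"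
      by (auto intro: generate.incl generate.inv)
    show "subgroup (generate G (insert a S)) G"
      using a assms(2) by (intro generate_is_subgroup) auto
  qed
  show ?thesis using *[OF assms(1)] *[of "inv a"] assms(1) by simp
qed

text \<open>\<open>E_EVEN_generated_R\<close> is transported along the homomorphism
  \<open>flip\<close>, which maps \<open>E_EVEN\<close> and the 3-colorable subgroup onto
  themselves, turns \<open>phi_R\<close> into \<open>phi_L\<close> and inverts
  \<open>x0_squared\<close>.\<close>

lemma E_EVEN_generated_L:
  "E_EVEN = generate thompson_F (insert x0_squared (phi_L ` three_colorable_subgroup))"
proof -
  interpret group_hom thompson_F thompson_F flip by (rule group_hom_flip)
  have phi_R: "phi_R ` three_colorable_subgroup \<subseteq> F_carrier"
    using phi_R_image_subset E_EVEN_iff by blast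
  have flip_image: "flip ` phi_R ` three_colorable_subgroup = phi_L ` three_colorable_subgroup"
    using image_flip[OF flip_in_three_colorable_subgroup]
    by (metis (no_types, lifting) flip_phi_R image_cong image_image)
  have "E_EVEN = flip ` E_EVEN" using image_flip[OF flip_in_E_EVEN] by simp
  also have "\<dots> = flip ` generate thompson_F (insert x0_squared (phi_R ` three_colorable_subgroup))"
    by (subst E_EVEN_generated_R) (rule refl)
  also have "\<dots> = generate thompson_F (flip ` insert x0_squared (phi_R ` three_colorable_subgroup))"
    using phi_R x0_squared_in_F_carrier by (intro generate_img[symmetric]) auto
  also have "flip ` insert x0_squared (phi_R ` three_colorable_subgroup) =
      insert (inv\<^bsub>thompson_F\<^esub> x0_squared) (phi_L ` three_colorable_subgroup)"
    by (simp only: image_insert flip_image flip_x0_squared)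
  also have "generate thompson_F \<dots> = generate thompson_F (insert x0_squared (phi_L ` three_colorable_subgroup))"
  proof (rule G.generate_insert_inv[OF x0_squared_in_F_carrier])
    show "phi_L ` three_colorable_subgroup \<subseteq> F_carrier"
      unfolding flip_image[symmetric] using phi_R flip_in_F_carrier by blast
  qed
  finally show ?thesis .
qed

theorem theorem2p9:
  "E_EVEN = generate thompson_F
              (insert (x0 [^]\<^bsub>thompson_F\<^esub> (2::nat)) (phi_R ` three_colorable_subgroup))
   \<and> E_EVEN = generate thompson_F
              (insert (x0 [^]\<^bsub>thompson_F\<^esub> (2::nat)) (phi_L ` three_colorable_subgroup))"
  using E_EVEN_generated_R E_EVEN_generated_L unfolding x0_squared_def by (rule conjI)

end
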